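(* Let $X$ be a (not necessarily closed) spin$^c$ manifold of dimension $4n+2$, with determinant line bundle $\mathcal{L}_X$ and spinor bundle $S(X)$, and let $\mathcal{L}_{\mathcal{H}}\subset\mathrm{End}_{\mathbb{R}}(S(X))$ be the subbundle defined in the context. Then there is a one-to-one correspondence between the sections of $\mathcal{L}_X$ and the sections of $\mathcal{L}_{\mathcal{H}}$, which preserves supports.
   Context: $X$ is an oriented Riemannian manifold with principal $Spin^c$-bundle $P_{Spin^c}(X)$. $S(X)=S(X)^0\oplus S(X)^1$ is its $\mathbb{Z}_2$-graded complex spinor bundle (Clifford convention $v^2=-|v|^2$). The determinant line bundle is $\mathcal{L}_X=P_{Spin^c}(X)\times_{z^2}\mathbb{C}$, where $[\mu,u]\in Spin^c=(Spin\times U(1))/\pm1$ acts on $\mathbb{C}$ by $u^2$. $\mathcal{L}_{\mathcal{H}}$ is the subbundle of $\mathrm{End}_{\mathbb{R}}(S(X))$ whose elements are of odd degree, anticommute with Clifford multiplication by tangent vectors, and are symmetric if $\dim X\equiv 2 \pmod 8$, respectively skew-symmetric if $\dim X\equiv 6\pmod 8$, with respect to the real inner product on $S(X)$. "Support" is used in the following sense: for a section of $\mathrm{End}_{\mathbb{R}}(S(X))$ it is the set of points of $X$ at which the endomorphism is not invertible, and for a section $h$ of $\mathcal{L}_X$ it is the zero set $h^{-1}(0)$. *)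

theory Defs
  imports "HOL-Analysis.Analysis" "HOL-Algebra.Coset"
begin

section \<open>Smooth maps between open subsets of normed spaces\<close>

primrec Ck_on :: "nat \<Rightarrow> 'a::real_normed_vector set \<Rightarrow> ('a \<Rightarrow> 'b::real_normed_vector) \<Rightarrow> bool" where
  "Ck_on 0 S f \<longleftrightarrow> continuous_on S f"
| "Ck_on (Suc k) S f \<longleftrightarrow> (\<forall>x\<in>S. f differentiable (at x)) \<and>
     (\<forall>v. Ck_on k S (\<lambda>x. frechet_derivative f (at x) v))"

definition smooth_on :: "'a::real_normed_vector set \<Rightarrow> ('a \<Rightarrow> 'b::real_normed_vector) \<Rightarrow> bool" where
  "smooth_on S f \<longleftrightarrow> (\<forall>k. Ck_on k S f)"


section \<open>The real Clifford algebra of \<open>real ^ 'm\<close>\<close>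

text \<open>
  The basis vector \<open>axis A 1\<close> stands for the ordered product of the \<open>e\<^sub>i\<close>, \<open>i \<in> A\<close>. The sign counts
  the transpositions needed to sort \<open>e\<^sub>A e\<^sub>B\<close> (pairs with \<open>b < a\<close>) together with one factor
  \<open>e\<^sub>i\<^sup>2 = -1\<close> for every \<open>i \<in> A \<inter> B\<close> (pairs with \<open>b = a\<close>).
\<close>

type_synonym 'm cl = "real ^ ('m set)"

definition cl_sign :: "'m::{finite,linorder} set \<Rightarrow> 'm set \<Rightarrow> real" where
  "cl_sign A B = (-1) ^ card {(a, b). a \<in> A \<and> b \<in> B \<and> b \<le> a}"

definition cl_mult :: "'m::{finite,linorder} cl \<Rightarrow> 'm cl \<Rightarrow> 'm cl" where
  "cl_mult x y = (\<Sum>A\<in>UNIV. \<Sum>B\<in>UNIV. (cl_sign A B * x $ A * y $ B) *\<^sub>R axis (sym_diff A B) 1)"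

definition cl_one :: "'m::{finite,linorder} cl" where
  "cl_one = axis {} 1"

definition cl_vec :: "real ^ 'm::{finite,linorder} \<Rightarrow> 'm::{finite,linorder} cl" where
  "cl_vec v = (\<Sum>i\<in>UNIV. v $ i *\<^sub>R axis {i} 1)"

lemma cl_sign_prod:
  "cl_sign A B = (\<Prod>a\<in>A. \<Prod>b\<in>B. if b \<le> a then -1 else 1)"
proof -
  have "(\<Prod>a\<in>A. \<Prod>b\<in>B. if b \<le> a then -1 else (1::real)) =
        (\<Prod>p\<in>A\<times>B. if snd p \<le> fst p then -1 else 1)"
    by (simp add: prod.cartesian_product case_prod_beta)
  also have "\<dots> = (-1) ^ card {p\<in>A\<times>B. snd p \<le> fst p}"
    by (simp add: prod.If_cases Int_def)
  also have "{p\<in>A\<times>B. snd p \<le> fst p} = {(a, b). a \<in> A \<and> b \<in> B \<and> b \<le> a}"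
    by auto
  finally show ?thesis by (simp add: cl_sign_def)
qed

lemma prod_sym_diff:
  fixes f :: "'a::finite \<Rightarrow> real"
  assumes "\<And>a. f a * f a = 1"
  shows "prod f (sym_diff A B) = prod f A * prod f B"
proof -
  have "prod f A = prod f (A - B) * prod f (A \<inter> B)"
    using prod.Int_Diff[of A f B] by (simp add: mult.commute)
  moreover have "prod f B = prod f (B - A) * prod f (A \<inter> B)"
    using prod.Int_Diff[of B f A] by (simp add: mult.commute Int_commute)
  moreover have "prod f (sym_diff A B) = prod f (A - B) * prod f (B - A)"
    by (rule prod.union_disjoint) auto
  moreover have "prod f (A \<inter> B) * prod f (A \<inter> B) = 1"
    by (simp add: prod.distrib[symmetric] assms)
  ultimately show ?thesis by (simp add: algebra_simps)
qed

lemma cl_sign_sym_diff: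
  "cl_sign (sym_diff A B) C = cl_sign A C * cl_sign B C"
  "cl_sign A (sym_diff B C) = cl_sign A B * cl_sign A C"
proof -
  have sq: "prod g S * prod g S = 1" if "\<And>a. g a * g a = (1::real)" for g and S :: "'a set"
    by (simp add: prod.distrib[symmetric] that)
  show "cl_sign (sym_diff A B) C = cl_sign A C * cl_sign B C"
    unfolding cl_sign_prod by (rule prod_sym_diff) (rule sq, simp)
  have "(\<Prod>b\<in>sym_diff B C. if b \<le> a then -1 else (1::real)) =
     (\<Prod>b\<in>B. if b \<le> a then -1 else 1) * (\<Prod>b\<in>C. if b \<le> a then -1 else 1)" for a
    by (rule prod_sym_diff) simp
  then show "cl_sign A (sym_diff B C) = cl_sign A B * cl_sign A C"
    unfolding cl_sign_prod by (simp add: prod.distrib)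
qed

lemma bilinear_cl_mult: "bilinear cl_mult"
  unfolding bilinear_def cl_mult_def
  by (auto intro!: linearI simp: algebra_simps sum.distrib scaleR_sum_right)

lemma cl_mult_axis:
  "cl_mult (axis A 1) (axis B 1) = cl_sign A B *\<^sub>R axis (sym_diff A B) 1"
proof -
  have "(cl_sign C D * axis A 1 $ C * axis B 1 $ D) *\<^sub>R axis (sym_diff C D) (1::real) =
      (if D = B then if C = A then cl_sign A B *\<^sub>R axis (sym_diff A B) 1 else 0 else 0)" for C D
    by (auto simp: axis_def)
  then show ?thesis by (simp add: cl_mult_def)
qed

lemma cl_expand: "x = (\<Sum>A\<in>UNIV. x $ A *\<^sub>R axis A (1::real))"
  by (simp add: vec_eq_iff axis_def if_distrib cong: if_cong)

lemma cl_mult_scaleR: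
  "cl_mult (r *\<^sub>R x) y = r *\<^sub>R cl_mult x y" "cl_mult x (r *\<^sub>R y) = r *\<^sub>R cl_mult x y"
  by (simp_all only: bilinear_lmul[OF bilinear_cl_mult] bilinear_rmul[OF bilinear_cl_mult])

lemma cl_mult_sum_left: "cl_mult (\<Sum>i\<in>S. c i *\<^sub>R f i) y = (\<Sum>i\<in>S. c i *\<^sub>R cl_mult (f i) y)"
proof -
  have "linear (\<lambda>x. cl_mult x y)"
    by (rule bilinear_cl_mult[unfolded bilinear_def, THEN conjunct2, rule_format])
  from linear_sum[OF this, of "\<lambda>i. c i *\<^sub>R f i" S] show ?thesis
    by (simp only: cl_mult_scaleR)
qed

lemma cl_mult_sum_right: "cl_mult x (\<Sum>i\<in>S. c i *\<^sub>R f i) = (\<Sum>i\<in>S. c i *\<^sub>R cl_mult x (f i))"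
proof -
  have "linear (cl_mult x)"
    by (rule bilinear_cl_mult[unfolded bilinear_def, THEN conjunct1, rule_format])
  from linear_sum[OF this, of "\<lambda>i. c i *\<^sub>R f i" S] show ?thesis
    by (simp only: cl_mult_scaleR)
qed

lemma cl_mult_assoc: "cl_mult (cl_mult x y) z = cl_mult x (cl_mult y z)"
proof -
  have sd: "sym_diff (sym_diff A B) C = sym_diff A (sym_diff B C)" for A B C :: "'a set"
    by auto
  have basis: "cl_mult (cl_mult (axis A 1) (axis B 1)) (axis C 1) =
        cl_mult (axis A 1) (cl_mult (axis B 1) (axis C 1))" for A B C :: "'a set"
    unfolding cl_mult_axis cl_mult_scaleR cl_sign_sym_diff sd by simp
  have "cl_mult (cl_mult (axis A 1) (axis B 1)) z =
        cl_mult (axis A 1) (cl_mult (axis B 1) z)" for A B :: "'a set"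
    by (subst (1 2) cl_expand[of z]) (simp only: cl_mult_sum_right basis)
  then have "cl_mult (cl_mult (axis A 1) y) z = cl_mult (axis A 1) (cl_mult y z)" for A :: "'a set"
    by (subst (1 2) cl_expand[of y]) (simp only: cl_mult_sum_right cl_mult_sum_left)
  then show ?thesis
    by (subst (1 2) cl_expand[of x]) (simp only: cl_mult_sum_left)
qed

lemma cl_mult_one [simp]: "cl_mult cl_one x = x" "cl_mult x cl_one = x"
proof -
  have s: "cl_sign {} A = 1" "cl_sign A {} = 1" for A :: "'a set"
    by (simp_all add: cl_sign_def)
  show "cl_mult cl_one x = x"
    by (subst (1 2) cl_expand[of x]) (simp add: cl_one_def cl_mult_sum_right cl_mult_axis s)
  show "cl_mult x cl_one = x"
    by (subst (1 2) cl_expand[of x]) (simp add: cl_one_def cl_mult_sum_left cl_mult_axis s)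
qed

lemma cl_vec_polar:
  "cl_mult (cl_vec v) (cl_vec w) + cl_mult (cl_vec w) (cl_vec v) = (- 2 * (v \<bullet> w)) *\<^sub>R cl_one"
proof -
  have e: "cl_mult (axis {i} 1) (axis {j} 1) + cl_mult (axis {j} 1) (axis {i} 1) =
           (if i = j then -2 else 0) *\<^sub>R cl_one" for i j :: 'a
  proof (cases "i = j")
    case True
    have "{(a, b). a \<in> {j} \<and> b \<in> {j} \<and> b \<le> a} = {(j, j)}" by auto
    with True show ?thesis
      by (simp add: cl_mult_axis cl_sign_def cl_one_def flip: scaleR_2)
  next
    case False
    have swap: "sym_diff {i} {j} = sym_diff {j} {i}" by auto
    have "cl_sign {i} {j} + cl_sign {j} {i} = 0"
      using False by (cases "i < j") (auto simp: cl_sign_prod)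
    with False show ?thesis
      unfolding cl_mult_axis swap by (simp flip: scaleR_add_left)
  qed
  have expand: "cl_mult (cl_vec v) (cl_vec w) =
      (\<Sum>i\<in>UNIV. \<Sum>j\<in>UNIV. (v $ i * w $ j) *\<^sub>R cl_mult (axis {i} 1) (axis {j} 1))" for v w :: "real ^ 'a::{finite,linorder}"
    by (simp only: cl_vec_def cl_mult_sum_left) (simp only: cl_mult_sum_right scaleR_sum_right scaleR_scaleR)
  have "cl_mult (cl_vec v) (cl_vec w) + cl_mult (cl_vec w) (cl_vec v) =
        (\<Sum>i\<in>UNIV. \<Sum>j\<in>UNIV. (v $ i * w $ j) *\<^sub>R cl_mult (axis {i} 1) (axis {j} 1)) +
        (\<Sum>j\<in>UNIV. \<Sum>i\<in>UNIV. (v $ i * w $ j) *\<^sub>R cl_mult (axis {j} 1) (axis {i} 1))"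
    unfolding expand by (simp add: mult.commute)
  also have "\<dots> = (\<Sum>i\<in>UNIV. \<Sum>j\<in>UNIV. (v $ i * w $ j) *\<^sub>R
        (cl_mult (axis {i} 1) (axis {j} 1) + cl_mult (axis {j} 1) (axis {i} 1)))"
    by (subst (2) sum.swap) (simp add: sum.distrib scaleR_add_right)
  also have "\<dots> = (\<Sum>i\<in>UNIV. \<Sum>j\<in>UNIV. if i = j then (-2 * (v $ i * w $ i)) *\<^sub>R cl_one else 0)"
    unfolding e by (intro sum.cong refl) simp
  also have "\<dots> = (- 2 * (v \<bullet> w)) *\<^sub>R cl_one"
    by (simp add: inner_vec_def sum_distrib_left scaleR_sum_left sum_negf)
  finally show ?thesis .
qed


section \<open>The groups \<open>Spin\<close> and \<open>Spin\<^sup>c\<close>\<close>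

definition spin_group :: "'m::{finite,linorder} cl monoid" where
  "spin_group = \<lparr>carrier = {foldr cl_mult (map cl_vec vs) cl_one | vs.
                              even (length vs) \<and> (\<forall>v\<in>set vs. norm v = 1)},
                 monoid.mult = cl_mult, one = cl_one\<rparr>"

definition U1_group :: "complex monoid" where
  "U1_group = \<lparr>carrier = sphere 0 1, monoid.mult = (*), one = 1\<rparr>"

type_synonym 'm spinc = "('m cl \<times> complex) set"

definition spinc_group :: "'m::{finite,linorder} spinc monoid" where
  "spinc_group = (spin_group \<times>\<times> U1_group) Mod {(cl_one, 1), (- cl_one, - 1)}"

text \<open>The covering \<open>Spin \<rightarrow> SO\<close>: \<open>\<mu> \<cdot> \<xi> \<cdot> \<mu>\<^sup>-\<^sup>1\<close> lies in the span of the \<open>e\<^sub>i\<close>, whose coordinates are read off.\<close>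

definition spin_ad :: "'m cl \<Rightarrow> real ^ 'm::{finite,linorder} \<Rightarrow> real ^ 'm::{finite,linorder}" where
  "spin_ad \<mu> \<xi> = (\<chi> i. cl_mult (cl_mult \<mu> (cl_vec \<xi>)) (inv\<^bsub>spin_group\<^esub> \<mu>) $ {i})"


section \<open>The complex spinor module\<close>

text \<open>The inner product of \<open>complex ^ 's\<close> is the real part of the standard Hermitian product.\<close>

definition complex_spinor_module ::
    "('m::{finite,linorder} cl \<Rightarrow> complex ^ 's ^ 's) \<Rightarrow> bool" where
  "complex_spinor_module \<rho> \<longleftrightarrow>
     linear \<rho> \<and> \<rho> cl_one = mat 1 \<and> (\<forall>x y. \<rho> (cl_mult x y) = \<rho> x ** \<rho> y) \<and>
     (\<forall>W. vec.subspace W \<and> (\<forall>x. \<forall>s\<in>W. \<rho> x *v s \<in> W) \<longrightarrow> W = {0} \<or> W = UNIV) \<and>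
     (\<forall>v s. norm v = 1 \<longrightarrow> norm (\<rho> (cl_vec v) *v s) = norm s)"

text \<open>The two eigenspaces of the complex volume element \<open>\<i>\<^bsup>m/2\<^esup> e\<^sub>1 \<dots> e\<^sub>m\<close> (for even \<open>m\<close>).\<close>

definition volume_action ::
    "('m::{finite,linorder} cl \<Rightarrow> complex ^ 's ^ 's) \<Rightarrow> complex ^ 's \<Rightarrow> complex ^ 's" where
  "volume_action \<rho> s = \<i> ^ (CARD('m) div 2) *s (\<rho> (axis UNIV 1) *v s)"

definition spinors0 :: "('m::{finite,linorder} cl \<Rightarrow> complex ^ 's ^ 's) \<Rightarrow> (complex ^ 's) set" where
  "spinors0 \<rho> = {s. volume_action \<rho> s = s}"

definition spinors1 :: "('m::{finite,linorder} cl \<Rightarrow> complex ^ 's ^ 's) \<Rightarrow> (complex ^ 's) set" where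
  "spinors1 \<rho> = {s. volume_action \<rho> s = - s}"


section \<open>Oriented Riemannian manifolds\<close>

text \<open>
  A chart is a pair of an open set and a coordinate map. A tangent vector at \<open>x\<close> assigns to every
  chart around \<open>x\<close> its coordinates there, related by the Jacobians of the coordinate changes
  (and \<open>0\<close> to everything else).
\<close>

type_synonym ('x, 'm) chart = "'x set \<times> ('x \<Rightarrow> real ^ 'm)"
type_synonym ('x, 'm) tvec = "('x, 'm) chart \<Rightarrow> real ^ 'm"

record ('x, 'm) riem_manifold =
  charts :: "('x, 'm) chart set"
  riem_metric :: "'x \<Rightarrow> ('x, 'm) tvec \<Rightarrow> ('x, 'm) tvec \<Rightarrow> real"

definition coord_inv :: "('x, 'm::finite) chart \<Rightarrow> real ^ 'm \<Rightarrow> 'x" where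
  "coord_inv c = inv_into (fst c) (snd c)"

definition coord_change :: "('x, 'm::finite) chart \<Rightarrow> ('x, 'm) chart \<Rightarrow> real ^ 'm \<Rightarrow> real ^ 'm" where
  "coord_change c d = snd d \<circ> coord_inv c"

definition tangent_vec ::
    "('x, 'm::finite, 'z) riem_manifold_scheme \<Rightarrow> ('x, 'm) chart \<Rightarrow> 'x \<Rightarrow> real ^ 'm \<Rightarrow> ('x, 'm) tvec" where
  "tangent_vec X c x \<xi> = (\<lambda>d. if d \<in> charts X \<and> x \<in> fst d
     then frechet_derivative (coord_change c d) (at (snd c x)) \<xi> else 0)"

definition tangent_space ::
    "('x, 'm::finite, 'z) riem_manifold_scheme \<Rightarrow> 'x \<Rightarrow> ('x, 'm) tvec set" where
  "tangent_space X x = {tangent_vec X c x \<xi> | c \<xi>. c \<in> charts X \<and> x \<in> fst c}"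

definition smooth_fun ::
    "('x, 'm::finite, 'z) riem_manifold_scheme \<Rightarrow> 'x set \<Rightarrow> ('x \<Rightarrow> 'b::real_normed_vector) \<Rightarrow> bool" where
  "smooth_fun X V f \<longleftrightarrow> (\<forall>c\<in>charts X. smooth_on (snd c ` (fst c \<inter> V)) (f \<circ> coord_inv c))"

definition oriented_smooth_atlas ::
    "('x::topological_space, 'm::finite, 'z) riem_manifold_scheme \<Rightarrow> bool" where
  "oriented_smooth_atlas X \<longleftrightarrow>
     (\<Union>c\<in>charts X. fst c) = UNIV \<and>
     (\<forall>c\<in>charts X. open (fst c) \<and> open (snd c ` fst c) \<and>
        homeomorphism (fst c) (snd c ` fst c) (snd c) (coord_inv c)) \<and>
     (\<forall>c\<in>charts X. \<forall>d\<in>charts X. smooth_on (snd c ` (fst c \<inter> fst d)) (coord_change c d) \<and>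
        (\<forall>x\<in>fst c \<inter> fst d. det (matrix (frechet_derivative (coord_change c d) (at (snd c x)))) > 0))"

definition riemannian_metric ::
    "('x::topological_space, 'm::finite, 'z) riem_manifold_scheme \<Rightarrow> bool" where
  "riemannian_metric X \<longleftrightarrow> (\<forall>c\<in>charts X.
     (\<forall>x\<in>fst c. let g = (\<lambda>\<xi> \<eta>. riem_metric X x (tangent_vec X c x \<xi>) (tangent_vec X c x \<eta>)) in
        bilinear g \<and> (\<forall>\<xi> \<eta>. g \<xi> \<eta> = g \<eta> \<xi>) \<and> (\<forall>\<xi>. \<xi> \<noteq> 0 \<longrightarrow> g \<xi> \<xi> > 0)) \<and>
     (\<forall>\<xi> \<eta>. smooth_fun X (fst c)
        (\<lambda>x. riem_metric X x (tangent_vec X c x \<xi>) (tangent_vec X c x \<eta>))))"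

definition oriented_riemannian_manifold ::
    "('x::{t2_space,second_countable_topology}, 'm::finite, 'z) riem_manifold_scheme \<Rightarrow> bool" where
  "oriented_riemannian_manifold X \<longleftrightarrow> oriented_smooth_atlas X \<and> riemannian_metric X"

definition oriented_orthonormal_frame ::
    "('x, 'm::finite, 'z) riem_manifold_scheme \<Rightarrow> 'x \<Rightarrow> (real ^ 'm \<Rightarrow> ('x, 'm) tvec) \<Rightarrow> bool" where
  "oriented_orthonormal_frame X x f \<longleftrightarrow>
     range f \<subseteq> tangent_space X x \<and>
     (\<forall>c\<in>charts X. x \<in> fst c \<longrightarrow> linear (\<lambda>\<xi>. f \<xi> c) \<and> det (matrix (\<lambda>\<xi>. f \<xi> c)) > 0) \<and>
     (\<forall>\<xi> \<eta>. riem_metric X x (f \<xi>) (f \<eta>) = \<xi> \<bullet> \<eta>)"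


section \<open>Principal \<open>Spin\<^sup>c\<close>-bundles\<close>

text \<open>
  The type \<open>'p\<close> is the total space of the principal bundle, \<open>ract\<close> the right action of \<open>Spin\<^sup>c\<close>, and
  \<open>frame\<close> the equivariant bundle map to the oriented orthonormal frame bundle. The smooth structure
  of the bundle is given by a bundle atlas of local sections with smooth transition functions; a map
  into \<open>Spin\<^sup>c\<close> is smooth if it lifts locally to a smooth map into \<open>Spin \<times> U(1)\<close>.
\<close>

record ('x, 'm, 'p) spinc_manifold = "('x, 'm) riem_manifold" +
  bproj :: "'p \<Rightarrow> 'x"
  ract :: "'p \<Rightarrow> 'm spinc \<Rightarrow> 'p"
  frame :: "'p \<Rightarrow> real ^ 'm::_ \<Rightarrow> ('x, 'm) tvec"
  local_sections :: "('x set \<times> ('x \<Rightarrow> 'p)) set"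

definition principal_spinc_bundle ::
    "('x::topological_space, 'm::{finite,linorder}, 'p) spinc_manifold \<Rightarrow> bool" where
  "principal_spinc_bundle X \<longleftrightarrow>
     (\<forall>p. ract X p \<one>\<^bsub>spinc_group\<^esub> = p) \<and>
     (\<forall>p. \<forall>g\<in>carrier spinc_group. \<forall>h\<in>carrier spinc_group.
        ract X (ract X p g) h = ract X p (g \<otimes>\<^bsub>spinc_group\<^esub> h)) \<and>
     (\<forall>p. \<forall>g\<in>carrier spinc_group. bproj X (ract X p g) = bproj X p) \<and>
     (\<forall>p q. bproj X p = bproj X q \<longrightarrow> (\<exists>!g. g \<in> carrier spinc_group \<and> q = ract X p g)) \<and>
     (\<Union>(V, \<sigma>)\<in>local_sections X. V) = UNIV \<and>
     (\<forall>(V, \<sigma>)\<in>local_sections X. open V \<and> (\<forall>x\<in>V. bproj X (\<sigma> x) = x)) \<and>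
     (\<forall>(V, \<sigma>)\<in>local_sections X. \<forall>(W, \<tau>)\<in>local_sections X. \<forall>x\<in>V \<inter> W.
        \<exists>N \<mu> u. open N \<and> x \<in> N \<and> N \<subseteq> V \<inter> W \<and> smooth_fun X N \<mu> \<and> smooth_fun X N u \<and>
          (\<forall>y\<in>N. \<exists>g\<in>carrier spinc_group. (\<mu> y, u y) \<in> g \<and> \<tau> y = ract X (\<sigma> y) g))"

definition spinc_frame_map ::
    "('x::topological_space, 'm::{finite,linorder}, 'p) spinc_manifold \<Rightarrow> bool" where
  "spinc_frame_map X \<longleftrightarrow>
     (\<forall>p. oriented_orthonormal_frame X (bproj X p) (frame X p)) \<and>
     (\<forall>p. \<forall>g\<in>carrier spinc_group. \<forall>(\<mu>, u)\<in>g. frame X (ract X p g) = frame X p \<circ> spin_ad \<mu>) \<and>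
     (\<forall>(V, \<sigma>)\<in>local_sections X. \<forall>c\<in>charts X. \<forall>\<xi>.
        smooth_fun X (V \<inter> fst c) (\<lambda>x. frame X (\<sigma> x) \<xi> c))"

definition is_spinc_manifold ::
    "('x::{t2_space,second_countable_topology}, 'm::{finite,linorder}, 'p) spinc_manifold \<Rightarrow> bool" where
  "is_spinc_manifold X \<longleftrightarrow>
     oriented_riemannian_manifold X \<and> principal_spinc_bundle X \<and> spinc_frame_map X"


section \<open>Associated bundles\<close>

text \<open>
  For a representation of \<open>Spin\<^sup>c\<close>, given on representatives \<open>(\<mu>, u)\<close>, the associated bundle
  identifies \<open>(p \<cdot> g, w)\<close> with \<open>(p, g w)\<close>. An element of the fibre over \<open>x\<close> is an equivalence class.
\<close>

definition assoc_rel ::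
    "('x, 'm::{finite,linorder}, 'p) spinc_manifold \<Rightarrow> ('m cl \<times> complex \<Rightarrow> 'v \<Rightarrow> 'v) \<Rightarrow>
     (('p \<times> 'v) \<times> ('p \<times> 'v)) set" where
  "assoc_rel X r = {((ract X p g, w), (p, r a w)) | p g a w. g \<in> carrier spinc_group \<and> a \<in> g}"

definition assoc_fibre ::
    "('x, 'm::{finite,linorder}, 'p) spinc_manifold \<Rightarrow> ('m cl \<times> complex \<Rightarrow> 'v \<Rightarrow> 'v) \<Rightarrow> 'x \<Rightarrow>
     ('p \<times> 'v) set set" where
  "assoc_fibre X r x = ({p. bproj X p = x} \<times> UNIV) // assoc_rel X r"

definition smooth_assoc_section_on ::
    "('x, 'm::{finite,linorder}, 'p) spinc_manifold \<Rightarrow> 'x set \<Rightarrow>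
     ('x \<Rightarrow> ('p \<times> 'v::real_normed_vector) set) \<Rightarrow> bool" where
  "smooth_assoc_section_on X U h \<longleftrightarrow> (\<forall>(V, \<sigma>)\<in>local_sections X.
     \<exists>f. smooth_fun X (U \<inter> V) f \<and> (\<forall>x\<in>U \<inter> V. (\<sigma> x, f x) \<in> h x))"


subsection \<open>The determinant line bundle\<close>

definition det_line :: "('x, 'm::{finite,linorder}, 'p) spinc_manifold \<Rightarrow> 'x \<Rightarrow> ('p \<times> complex) set set" where
  "det_line X = assoc_fibre X (\<lambda>(\<mu>, u) z. u\<^sup>2 * z)"

definition det_line_sections ::
    "('x, 'm::{finite,linorder}, 'p) spinc_manifold \<Rightarrow> ('x \<Rightarrow> ('p \<times> complex) set) set" where
  "det_line_sections X = {h. (\<forall>x. h x \<in> det_line X x) \<and> smooth_assoc_section_on X UNIV h}"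

definition det_line_support :: "('x \<Rightarrow> ('p \<times> complex) set) \<Rightarrow> 'x set" where
  "det_line_support h = {x. \<exists>p. (p, 0) \<in> h x}"


subsection \<open>The spinor bundle\<close>

text \<open>
  The vector space structure, the real inner product, the grading and Clifford multiplication are
  those of the spinor module: an element \<open>e\<close> of the fibre contains exactly one pair \<open>(p, s)\<close> for each
  \<open>p\<close> over the base point. A tangent vector \<open>v = frame p \<xi>\<close> acts on \<open>[p, s]\<close> through \<open>\<xi>\<close>.
\<close>

type_synonym ('p, 's) spinor = "('p \<times> (complex ^ 's)) set"

definition spinor_bundle ::
    "('x, 'm::{finite,linorder}, 'p) spinc_manifold \<Rightarrow> ('m cl \<Rightarrow> complex ^ 's ^ 's) \<Rightarrow> 'x \<Rightarrow>
     ('p, 's) spinor set" where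
  "spinor_bundle X \<rho> = assoc_fibre X (\<lambda>(\<mu>, u) s. u *s (\<rho> \<mu> *v s))"

definition spinor_bundle0 ::
    "('x, 'm::{finite,linorder}, 'p) spinc_manifold \<Rightarrow> ('m cl \<Rightarrow> complex ^ 's ^ 's) \<Rightarrow> 'x \<Rightarrow>
     ('p, 's) spinor set" where
  "spinor_bundle0 X \<rho> x = {e \<in> spinor_bundle X \<rho> x. \<forall>(p, s)\<in>e. s \<in> spinors0 \<rho>}"

definition spinor_bundle1 ::
    "('x, 'm::{finite,linorder}, 'p) spinc_manifold \<Rightarrow> ('m cl \<Rightarrow> complex ^ 's ^ 's) \<Rightarrow> 'x \<Rightarrow>
     ('p, 's) spinor set" where
  "spinor_bundle1 X \<rho> x = {e \<in> spinor_bundle X \<rho> x. \<forall>(p, s)\<in>e. s \<in> spinors1 \<rho>}"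

definition spinor_add :: "('p, 's::finite) spinor \<Rightarrow> ('p, 's) spinor \<Rightarrow> ('p, 's) spinor" where
  "spinor_add e e' = {(p, s + t) | p s t. (p, s) \<in> e \<and> (p, t) \<in> e'}"

definition spinor_scale :: "real \<Rightarrow> ('p, 's::finite) spinor \<Rightarrow> ('p, 's) spinor" where
  "spinor_scale r e = {(p, r *\<^sub>R s) | p s. (p, s) \<in> e}"

definition spinor_inner :: "('p, 's::finite) spinor \<Rightarrow> ('p, 's) spinor \<Rightarrow> real" where
  "spinor_inner e e' = (THE r. \<exists>p s t. (p, s) \<in> e \<and> (p, t) \<in> e' \<and> r = s \<bullet> t)"

definition clifford ::
    "('x, 'm::{finite,linorder}, 'p) spinc_manifold \<Rightarrow> ('m cl \<Rightarrow> complex ^ 's ^ 's) \<Rightarrow> ('x, 'm) tvec \<Rightarrow>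
     ('p, 's) spinor \<Rightarrow> ('p, 's) spinor" where
  "clifford X \<rho> v e = {(p, \<rho> (cl_vec \<xi>) *v s) | p \<xi> s. (p, s) \<in> e \<and> frame X p \<xi> = v}"


subsection \<open>The endomorphism bundle and its subbundle \<open>\<L>\<^sub>\<H>\<close>\<close>

definition spinor_End ::
    "('x, 'm::{finite,linorder}, 'p) spinc_manifold \<Rightarrow> ('m cl \<Rightarrow> complex ^ 's ^ 's) \<Rightarrow> 'x \<Rightarrow>
     (('p, 's) spinor \<Rightarrow> ('p, 's) spinor) set" where
  "spinor_End X \<rho> x = {T \<in> spinor_bundle X \<rho> x \<rightarrow>\<^sub>E spinor_bundle X \<rho> x.
     (\<forall>e\<in>spinor_bundle X \<rho> x. \<forall>e'\<in>spinor_bundle X \<rho> x.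
        T (spinor_add e e') = spinor_add (T e) (T e')) \<and>
     (\<forall>r. \<forall>e\<in>spinor_bundle X \<rho> x. T (spinor_scale r e) = spinor_scale r (T e))}"

definition LH_bundle ::
    "('x, 'm::{finite,linorder}, 'p) spinc_manifold \<Rightarrow> ('m cl \<Rightarrow> complex ^ 's ^ 's) \<Rightarrow> 'x \<Rightarrow>
     (('p, 's) spinor \<Rightarrow> ('p, 's) spinor) set" where
  "LH_bundle X \<rho> x = {T \<in> spinor_End X \<rho> x.
     T ` spinor_bundle0 X \<rho> x \<subseteq> spinor_bundle1 X \<rho> x \<and>
     T ` spinor_bundle1 X \<rho> x \<subseteq> spinor_bundle0 X \<rho> x \<and>
     (\<forall>v\<in>tangent_space X x. \<forall>e\<in>spinor_bundle X \<rho> x.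
        T (clifford X \<rho> v e) = spinor_scale (- 1) (clifford X \<rho> v (T e))) \<and>
     (CARD('m) mod 8 = 2 \<longrightarrow> (\<forall>e\<in>spinor_bundle X \<rho> x. \<forall>e'\<in>spinor_bundle X \<rho> x.
        spinor_inner (T e) e' = spinor_inner e (T e'))) \<and>
     (CARD('m) mod 8 = 6 \<longrightarrow> (\<forall>e\<in>spinor_bundle X \<rho> x. \<forall>e'\<in>spinor_bundle X \<rho> x.
        spinor_inner (T e) e' = - spinor_inner e (T e')))}"

text \<open>A section of the endomorphism bundle is smooth if it maps smooth local spinor fields to such.\<close>

definition smooth_End_section ::
    "('x::topological_space, 'm::{finite,linorder}, 'p) spinc_manifold \<Rightarrow>
     ('m cl \<Rightarrow> complex ^ 's ^ 's) \<Rightarrow>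
     ('x \<Rightarrow> ('p, 's) spinor \<Rightarrow> ('p, 's) spinor) \<Rightarrow> bool" where
  "smooth_End_section X \<rho> H \<longleftrightarrow> (\<forall>U \<psi>. open U \<and> (\<forall>x\<in>U. \<psi> x \<in> spinor_bundle X \<rho> x) \<and>
     smooth_assoc_section_on X U \<psi> \<longrightarrow> smooth_assoc_section_on X U (\<lambda>x. H x (\<psi> x)))"

definition LH_sections ::
    "('x::topological_space, 'm::{finite,linorder}, 'p) spinc_manifold \<Rightarrow>
     ('m cl \<Rightarrow> complex ^ 's ^ 's) \<Rightarrow>
     ('x \<Rightarrow> ('p, 's) spinor \<Rightarrow> ('p, 's) spinor) set" where
  "LH_sections X \<rho> = {H. (\<forall>x. H x \<in> LH_bundle X \<rho> x) \<and> smooth_End_section X \<rho> H}"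

definition End_support ::
    "('x, 'm::{finite,linorder}, 'p) spinc_manifold \<Rightarrow> ('m cl \<Rightarrow> complex ^ 's ^ 's) \<Rightarrow>
     ('x \<Rightarrow> ('p, 's) spinor \<Rightarrow> ('p, 's) spinor) \<Rightarrow> 'x set" where
  "End_support X \<rho> H =
     {x. \<not> bij_betw (H x) (spinor_bundle X \<rho> x) (spinor_bundle X \<rho> x)}"

end

theory Submission
  imports Defs "HOL-Computational_Algebra.Fundamental_Theorem_Algebra"
begin

text \<open>
  Let \<open>m = 4n + 2\<close>, and let \<open>p\<close> be a point of the principal bundle over \<open>x\<close>. It identifies the
  spinor fibre at \<open>x\<close> with the spinor module, and an element of the fibre of \<open>\<L>\<^sub>\<H>\<close> with an odd
  real-linear map \<open>T\<close> of the module that anticommutes with Clifford multiplication by vectors. As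
  \<open>m\<close> is even, \<open>T\<close> commutes with the volume element \<open>\<omega> = e\<^sub>1 \<dots> e\<^sub>m\<close>; being odd, it anticommutes with
  \<open>\<i>\<^bsup>m/2\<^esup> \<omega>\<close>. Since \<open>m/2\<close> is odd, this means \<open>T \<i> = - \<i> T\<close>: the map \<open>T\<close> is antilinear. By Schur's
  lemma the antilinear maps that anticommute with vectors form a complex line, spanned by one
  invertible map \<open>J\<close> (\<open>charge_conj\<close>); so \<open>T = c J\<close> for a complex number \<open>c\<close>
  (\<open>odd_anticommuting_endomorphism\<close>).

  The map \<open>J\<close> commutes with \<open>Spin\<close>, while \<open>J u = u\<^sup>-\<^sup>1 J\<close> for \<open>u\<close> in \<open>U(1)\<close>. Conjugation of \<open>c J\<close> by
  \<open>[\<mu>, u]\<close> therefore gives \<open>u\<^sup>2 c J\<close>, so that \<open>c\<close> changes with \<open>p\<close> exactly like the coordinate of an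
  element of the determinant line (\<open>charge_conj_spinor_rep\<close>). This is the correspondence
  \<open>line_endo\<close>; it is bijective in every fibre (\<open>bij_betw_line_endo\<close>), and \<open>c J\<close> is invertible if
  and only if \<open>c \<noteq> 0\<close>, so supports agree (\<open>bij_line_endo_iff\<close>). It preserves smoothness because
  \<open>c J s\<close> is real-bilinear in \<open>c\<close> and \<open>s\<close>; conversely \<open>c\<close> is recovered as a component of \<open>c J s\<close> for
  a constant \<open>s\<close> such that \<open>J s\<close> is a basis vector (\<open>smooth_line_endo_iff\<close>).

  What remains is that \<open>J\<close> exists and that its symmetry type is the one in the definition of \<open>\<L>\<^sub>\<H>\<close>.
  Write \<open>J s = A s'\<close>, where \<open>s'\<close> is the complex conjugate of \<open>s\<close>. Clifford multiplication \<open>\<gamma>(v)\<close> is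
  skew-adjoint, so \<open>J\<close> anticommutes with it if and only if \<open>\<gamma>(v) A = A \<gamma>(v)\<^sup>T\<close>. This condition is
  invariant under \<open>A \<mapsto> A\<^sup>T\<close>, so \<open>A\<^sup>T = \<plusminus>A\<close>, and \<open>J\<close> is symmetric or skew accordingly. The sign is
  found as for the Frobenius--Schur indicator. The average of a matrix \<open>B\<close> over the products of
  basis vectors always satisfies the condition. The operator \<open>B \<mapsto> average B\<close> has trace \<open>d\<^sup>2\<close>,
  \<open>d\<close> being the complex dimension of the module, because all basis elements but \<open>1\<close> have trace zero;
  in particular it is not zero. The operator \<open>B \<mapsto> (average B)\<^sup>T = \<plusminus> average B\<close> has trace
  \<open>(-1)\<^sup>n 2\<^bsup>2n+1\<^esup> d\<close>, because the trace of \<open>e\<^sub>S\<^sup>2\<close> only depends on \<open>|S|\<close> modulo 4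
  (\<open>sum_cl_sign_self\<close>). Comparing signs gives \<open>A\<^sup>T = (-1)\<^sup>n A\<close> (\<open>intertwiner_exists\<close>), and \<open>n\<close> is even
  if and only if \<open>m \<equiv> 2\<close> modulo 8.
\<close>


section \<open>Calculus of \<open>C\<^sup>k\<close> maps on open sets\<close>

lemma Ck_on_subset: "Ck_on k T f \<Longrightarrow> S \<subseteq> T \<Longrightarrow> Ck_on k S f"
  by (induction k arbitrary: f) (auto intro: continuous_on_subset)

text \<open>
  The derivatives in \<open>Ck_on\<close> are two-sided derivatives at points, so agreement on \<open>S\<close> only passes
  to derivatives because \<open>S\<close> is open.
\<close>

lemma Ck_on_cong:
  assumes "open S" and "\<And>x. x \<in> S \<Longrightarrow> f x = g x" and "Ck_on k S f"
  shows "Ck_on k S g"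
  using assms(2,3)
proof (induction k arbitrary: f g)
  case 0
  then show ?case by (simp cong: continuous_on_cong)
next
  case (Suc k)
  have D: "(g has_derivative D) (at x)" if "(f has_derivative D) (at x)" "x \<in> S" for D x
    using has_derivative_transform_within_open[OF that(1) assms(1) that(2)] Suc.prems(1) by auto
  have F: "(f has_derivative frechet_derivative f (at x)) (at x)" if "x \<in> S" for x
    using Suc.prems(2) that by (simp add: frechet_derivative_works)
  have eq: "frechet_derivative f (at x) = frechet_derivative g (at x)" if "x \<in> S" for x
    using frechet_derivative_at[OF D[OF F[OF that] that]] .
  have "g differentiable (at x)" if "x \<in> S" for x
    using D[OF F[OF that] that] by (auto simp: differentiable_def)
  moreover have "Ck_on k S (\<lambda>x. frechet_derivative g (at x) v)" for v
    by (rule Suc.IH[of "\<lambda>x. frechet_derivative f (at x) v"]) (use eq Suc.prems(2) in auto)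
  ultimately show ?case by simp
qed

lemma Ck_on_Suc_imp_Ck_on: "Ck_on (Suc k) S f \<Longrightarrow> Ck_on k S f"
proof (induction k arbitrary: f)
  case 0
  then show ?case
    by (auto intro!: continuous_at_imp_continuous_on differentiable_imp_continuous_within)
next
  case (Suc k)
  from Suc.prems have "\<forall>x\<in>S. f differentiable (at x)"
    and "\<And>v. Ck_on (Suc k) S (\<lambda>x. frechet_derivative f (at x) v)" by auto
  with Suc.IH show ?case by simp
qed

lemma Ck_on_localI:
  assumes "\<And>x. x \<in> S \<Longrightarrow> \<exists>N. open N \<and> x \<in> N \<and> Ck_on k N f"
  shows "Ck_on k S f"
  using assms
proof (induction k arbitrary: f)
  case 0
  show ?case
    unfolding Ck_on.simps
  proof (rule continuous_at_imp_continuous_on, rule ballI)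
    fix x assume "x \<in> S"
    with 0 obtain N where "open N" "x \<in> N" "continuous_on N f" by auto
    then show "isCont f x" by (simp add: continuous_on_eq_continuous_at)
  qed
next
  case (Suc k)
  show ?case
    unfolding Ck_on.simps
  proof (intro conjI allI ballI)
    fix x assume "x \<in> S"
    with Suc.prems show "f differentiable (at x)" by force
  next
    fix v
    show "Ck_on k S (\<lambda>x. frechet_derivative f (at x) v)"
    proof (rule Suc.IH)
      fix x assume "x \<in> S"
      with Suc.prems obtain N where "open N" "x \<in> N" "Ck_on (Suc k) N f" by blast
      then show "\<exists>N. open N \<and> x \<in> N \<and> Ck_on k N (\<lambda>x. frechet_derivative f (at x) v)" by auto
    qed
  qed
qed

lemma Ck_on_const: "Ck_on k S (\<lambda>x. c)"
  by (induction k arbitrary: c) (auto simp: frechet_derivative_const)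

lemma Ck_on_add:
  assumes "open S" "Ck_on k S f" "Ck_on k S g"
  shows "Ck_on k S (\<lambda>x. f x + g x)"
  using assms(2,3)
proof (induction k arbitrary: f g)
  case 0
  then show ?case by (simp add: continuous_on_add)
next
  case (Suc k)
  have D: "((\<lambda>x. f x + g x) has_derivative
      (\<lambda>v. frechet_derivative f (at x) v + frechet_derivative g (at x) v)) (at x)" if "x \<in> S" for x
    using Suc.prems that by (intro has_derivative_add) (auto simp: frechet_derivative_works)
  have eq: "frechet_derivative f (at x) v + frechet_derivative g (at x) v =
      frechet_derivative (\<lambda>x. f x + g x) (at x) v" if "x \<in> S" for x v
    using fun_cong[OF frechet_derivative_at[OF D[OF that]]] .
  have "Ck_on k S (\<lambda>x. frechet_derivative (\<lambda>x. f x + g x) (at x) v)" for v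
    by (rule Ck_on_cong[OF assms(1) eq Suc.IH]) (use Suc.prems in auto)
  then show ?case using Suc.prems by auto
qed

text \<open>
  The product rule expresses the derivative by two products whose factors are \<open>C\<^sup>k\<close>, so induction
  on \<open>k\<close> applies.
\<close>

lemma Ck_on_bounded_bilinear:
  assumes "bounded_bilinear B" "open S" "Ck_on k S f" "Ck_on k S g"
  shows "Ck_on k S (\<lambda>x. B (f x) (g x))"
  using assms(3,4)
proof (induction k arbitrary: f g)
  case 0
  then show ?case using bounded_bilinear.continuous_on[OF assms(1)] by auto
next
  case (Suc k)
  have D: "((\<lambda>x. B (f x) (g x)) has_derivative
      (\<lambda>v. B (f x) (frechet_derivative g (at x) v) + B (frechet_derivative f (at x) v) (g x))) (at x)"
    if "x \<in> S" for x
    using Suc.prems that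
    by (intro bounded_bilinear.FDERIV[OF assms(1)]) (auto simp: frechet_derivative_works)
  have eq: "B (f x) (frechet_derivative g (at x) v) + B (frechet_derivative f (at x) v) (g x) =
      frechet_derivative (\<lambda>x. B (f x) (g x)) (at x) v" if "x \<in> S" for x v
    using fun_cong[OF frechet_derivative_at[OF D[OF that]]] .
  have fg: "Ck_on k S f" "Ck_on k S g" using Suc.prems by (auto intro: Ck_on_Suc_imp_Ck_on simp del: Ck_on.simps)
  have "Ck_on k S (\<lambda>x. frechet_derivative (\<lambda>x. B (f x) (g x)) (at x) v)" for v
    by (rule Ck_on_cong[OF assms(2) eq], assumption, rule Ck_on_add[OF assms(2)]; rule Suc.IH)
       (use Suc.prems fg in auto)
  moreover have "(\<lambda>x. B (f x) (g x)) differentiable (at x)" if "x \<in> S" for x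
    using D[OF that] by (auto simp: differentiable_def)
  ultimately show ?case by simp
qed

text \<open>
  A linear map is treated as the bilinear map \<open>(r, x) \<mapsto> r L x\<close> with \<open>r\<close> constantly 1.
\<close>

lemma Ck_on_bounded_linear:
  assumes "bounded_linear L" "open S" "Ck_on k S f"
  shows "Ck_on k S (\<lambda>x. L (f x))"
proof -
  have "bounded_bilinear (\<lambda>r x. r *\<^sub>R L x)"
    using bounded_bilinear.comp[OF bounded_bilinear_scaleR bounded_linear_ident assms(1)] .
  from Ck_on_bounded_bilinear[OF this assms(2) Ck_on_const assms(3), of 1] show ?thesis by simp
qed

section \<open>Charts and smooth functions on a manifold\<close>

locale smooth_atlas =
  fixes X :: "('x::topological_space, 'm::finite, 'z) riem_manifold_scheme"
  assumes atlas: "oriented_smooth_atlas X"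
begin

lemma chart_at: obtains c where "c \<in> charts X" "x \<in> fst c"
  using atlas unfolding oriented_smooth_atlas_def by blast

lemma chart_homeomorphism:
  "c \<in> charts X \<Longrightarrow> homeomorphism (fst c) (snd c ` fst c) (snd c) (coord_inv c)"
  using atlas unfolding oriented_smooth_atlas_def by blast

lemma open_chart: "c \<in> charts X \<Longrightarrow> open (fst c)" "c \<in> charts X \<Longrightarrow> open (snd c ` fst c)"
  using atlas unfolding oriented_smooth_atlas_def by blast+

lemma coord_inv [simp]: "c \<in> charts X \<Longrightarrow> x \<in> fst c \<Longrightarrow> coord_inv c (snd c x) = x"
  using chart_homeomorphism by (auto simp: homeomorphism_def)

lemma open_chart_image:
  assumes "c \<in> charts X" "open N"
  shows "open (snd c ` (fst c \<inter> N))"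
proof -
  have "openin (top_of_set (snd c ` fst c)) (snd c ` (fst c \<inter> N))"
    by (rule homeomorphism_imp_open_map[OF chart_homeomorphism[OF assms(1)]])
       (simp add: assms(2) openin_open_Int)
  then show ?thesis using open_chart(2)[OF assms(1)] by (simp add: openin_open_eq)
qed

lemma smooth_fun_subset: "smooth_fun X V f \<Longrightarrow> W \<subseteq> V \<Longrightarrow> smooth_fun X W f"
  unfolding smooth_fun_def smooth_on_def by (blast intro: Ck_on_subset)

lemma smooth_fun_bounded_bilinear:
  assumes "bounded_bilinear B" "open V" "smooth_fun X V f" "smooth_fun X V g"
  shows "smooth_fun X V (\<lambda>x. B (f x) (g x))"
  using assms Ck_on_bounded_bilinear[OF assms(1) open_chart_image]
  unfolding smooth_fun_def smooth_on_def o_def by blast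

lemma smooth_fun_bounded_linear:
  assumes "bounded_linear L" "open V" "smooth_fun X V f"
  shows "smooth_fun X V (\<lambda>x. L (f x))"
  using assms Ck_on_bounded_linear[OF assms(1) open_chart_image]
  unfolding smooth_fun_def smooth_on_def o_def by blast

lemma smooth_fun_localI:
  assumes "\<And>x. x \<in> V \<Longrightarrow> \<exists>N g. open N \<and> x \<in> N \<and> smooth_fun X N g \<and> (\<forall>y\<in>N. g y = f y)"
  shows "smooth_fun X V f"
  unfolding smooth_fun_def smooth_on_def
proof (intro ballI allI Ck_on_localI)
  fix c k \<xi> assume c: "c \<in> charts X" and "\<xi> \<in> snd c ` (fst c \<inter> V)"
  then obtain x where x: "\<xi> = snd c x" "x \<in> fst c" "x \<in> V" by auto
  from assms[OF x(3)] obtain N g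
    where N: "open N" "x \<in> N" "smooth_fun X N g" "\<And>y. y \<in> N \<Longrightarrow> g y = f y" by blast
  let ?N = "snd c ` (fst c \<inter> N)"
  have "Ck_on k ?N (g \<circ> coord_inv c)"
    using N(3) c by (simp add: smooth_fun_def smooth_on_def)
  then have "Ck_on k ?N (f \<circ> coord_inv c)"
    by (rule Ck_on_cong[OF open_chart_image[OF c N(1)], rotated]) (use c N(4) in auto)
  then show "\<exists>M. open M \<and> \<xi> \<in> M \<and> Ck_on k M (f \<circ> coord_inv c)"
    using open_chart_image[OF c N(1)] x N(2) by blast
qed

lemma coord_change_differentiable:
  assumes "c \<in> charts X" "d \<in> charts X" "x \<in> fst c" "x \<in> fst d"
  shows "coord_change c d differentiable (at (snd c x))"
proof -
  have "smooth_on (snd c ` (fst c \<inter> fst d)) (coord_change c d)"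
    using atlas assms unfolding oriented_smooth_atlas_def by blast
  then have "Ck_on (Suc 0) (snd c ` (fst c \<inter> fst d)) (coord_change c d)"
    unfolding smooth_on_def by blast
  then show ?thesis using assms by auto
qed

text \<open>
  The cocycle identity of the Jacobians is the chain rule.
\<close>

lemma frechet_derivative_coord_change:
  assumes "c \<in> charts X" "d \<in> charts X" "e \<in> charts X" "x \<in> fst c" "x \<in> fst d" "x \<in> fst e"
  shows "frechet_derivative (coord_change d e) (at (snd d x))
           (frechet_derivative (coord_change c d) (at (snd c x)) \<xi>) =
         frechet_derivative (coord_change c e) (at (snd c x)) \<xi>"
proof -
  let ?cd = "coord_change c d" and ?de = "coord_change d e" and ?ce = "coord_change c e"
  let ?S = "snd c ` (fst c \<inter> fst d)"
  have p: "?cd (snd c x) = snd d x" using assms by (simp add: coord_change_def)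
  have "(?de \<circ> ?cd has_derivative
      frechet_derivative ?de (at (?cd (snd c x))) \<circ> frechet_derivative ?cd (at (snd c x))) (at (snd c x))"
    using coord_change_differentiable assms
    by (intro diff_chain_at) (simp_all add: p flip: frechet_derivative_works)
  then have "(?ce has_derivative
      frechet_derivative ?de (at (?cd (snd c x))) \<circ> frechet_derivative ?cd (at (snd c x))) (at (snd c x))"
    by (rule has_derivative_transform_within_open[of _ _ _ _ ?S])
       (use assms open_chart_image[OF assms(1) open_chart(1)[OF assms(2)]] in
         \<open>auto simp: coord_change_def\<close>)
  from fun_cong[OF frechet_derivative_at[OF this], of \<xi>] show ?thesis by (simp add: p)
qed

text \<open>
  By the cocycle identity a tangent vector given in one chart can be expressed in every other chart
  around the base point; hence its coordinates in a single chart determine it.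
\<close>

lemma tangent_vec_coordinates:
  assumes "v \<in> tangent_space X x" "c \<in> charts X" "x \<in> fst c"
  shows "v = tangent_vec X c x (v c)"
  using assms frechet_derivative_coord_change[of _ c _ x]
  by (fastforce simp: tangent_space_def tangent_vec_def)

text \<open>
  Injectivity follows from the isometry condition. A frame is also onto, since in the coordinates of
  a chart it is a linear map with nonzero determinant, and these coordinates determine a tangent
  vector.
\<close>

lemma bij_oriented_orthonormal_frame:
  assumes "oriented_orthonormal_frame X x f"
  shows "bij_betw f UNIV (tangent_space X x)"
proof -
  have inj: "inj f"
  proof (rule injI)
    fix \<xi> \<eta> assume "f \<xi> = f \<eta>"
    then have "\<xi> \<bullet> \<zeta> = \<eta> \<bullet> \<zeta>" for \<zeta>
      using assms by (metis oriented_orthonormal_frame_def)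
    then show "\<xi> = \<eta>" by (metis inner_commute vector_eq_rdot)
  qed
  have "v \<in> range f" if v: "v \<in> tangent_space X x" for v
  proof -
    obtain c where c: "c \<in> charts X" "x \<in> fst c" by (rule chart_at)
    have lin: "linear (\<lambda>\<xi>. f \<xi> c)" and det: "det (matrix (\<lambda>\<xi>. f \<xi> c)) > 0"
      using assms c by (auto simp: oriented_orthonormal_frame_def)
    have "invertible (matrix (\<lambda>\<xi>. f \<xi> c))" using det by (simp add: invertible_det_nz)
    then obtain B where "matrix (\<lambda>\<xi>. f \<xi> c) ** B = mat 1" unfolding invertible_def by blast
    then have "f (B *v v c) c = v c"
      using fun_cong[OF matrix_vector_mul(2)[OF lin], of "B *v v c"]
      by (simp add: matrix_vector_mul_assoc)
    moreover have "f (B *v v c) \<in> tangent_space X x"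
      using assms by (auto simp: oriented_orthonormal_frame_def)
    ultimately have "f (B *v v c) = v"
      using tangent_vec_coordinates[OF _ c] v by metis
    then show ?thesis by (metis rangeI)
  qed
  with inj assms show ?thesis by (auto simp: bij_betw_def oriented_orthonormal_frame_def)
qed

end

section \<open>Complex matrices\<close>

lemma matrix_mult_sum_left: "(\<Sum>i\<in>I. f i) ** B = (\<Sum>i\<in>I. f i ** B)"
  for f :: "'i \<Rightarrow> complex ^ 'a ^ 'b"
  by (simp add: vec_eq_iff matrix_matrix_mult_def sum_distrib_right sum.swap[of _ UNIV])

lemma matrix_mult_sum_right: "B ** (\<Sum>i\<in>I. f i) = (\<Sum>i\<in>I. B ** f i)"
  for f :: "'i \<Rightarrow> complex ^ 'a ^ 'b"
  by (simp add: vec_eq_iff matrix_matrix_mult_def sum_distrib_left sum.swap[of _ UNIV])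

lemma matrix_mult_scaleR:
  fixes A :: "complex ^ 'a ^ 'b" and B :: "complex ^ 'c ^ 'a"
  shows "(r *\<^sub>R A) ** B = r *\<^sub>R (A ** B)" "A ** (r *\<^sub>R B) = r *\<^sub>R (A ** B)"
  by (simp_all add: vec_eq_iff matrix_matrix_mult_def scaleR_sum_right)

lemma matrix_vector_scaleR:
  fixes A :: "complex ^ 'a ^ 'b"
  shows "(r *\<^sub>R A) *v x = r *\<^sub>R (A *v x)" "A *v (r *\<^sub>R x) = r *\<^sub>R (A *v x)"
  by (simp_all add: vec_eq_iff matrix_vector_mult_def scaleR_sum_right)

lemma transpose_scaleR: "transpose (r *\<^sub>R A) = r *\<^sub>R transpose (A :: complex ^ 'a ^ 'b)"
  by (simp add: vec_eq_iff transpose_def)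

lemma vector_scaleR_eq: "r *\<^sub>R x = complex_of_real r *s x" for x :: "complex ^ 'a"
  by (simp add: vec_eq_iff) (simp add: scaleR_conv_of_real)

subsection \<open>Eigenvectors\<close>

text \<open>
  The value \<open>p(C) v\<close> of a polynomial in a matrix on a vector, by Horner's scheme.
\<close>

definition poly_matrix :: "complex ^ 's ^ 's \<Rightarrow> complex poly \<Rightarrow> complex ^ 's \<Rightarrow> complex ^ 's" where
  "poly_matrix C p v = fold_coeffs (\<lambda>a w. a *s v + C *v w) p 0"

lemma poly_matrix_0 [simp]: "poly_matrix C 0 v = 0"
  by (simp add: poly_matrix_def)

lemma poly_matrix_pCons [simp]: "poly_matrix C (pCons a p) v = a *s v + C *v poly_matrix C p v"
  by (cases "p = 0 \<and> a = 0") (auto simp: poly_matrix_def)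

lemma poly_matrix_add: "poly_matrix C (p + q) v = poly_matrix C p v + poly_matrix C q v"
  by (induction p q rule: poly_induct2) (simp_all add: algebra_simps vec.scale_left_distrib)

lemma poly_matrix_smult: "poly_matrix C (smult c p) v = c *s poly_matrix C p v"
  by (induction p) (simp_all add: vec.scale_right_distrib vector_scalar_commute)

lemma poly_matrix_sum: "poly_matrix C (\<Sum>i\<in>I. f i) v = (\<Sum>i\<in>I. poly_matrix C (f i) v)"
  by (induction I rule: infinite_finite_induct) (simp_all add: poly_matrix_add)

lemma poly_matrix_root_factor:
  "poly_matrix C ([:-z, 1:] * q) v = C *v poly_matrix C q v - z *s poly_matrix C q v"
proof -
  have "[:-z, 1:] * q = smult (-z) q + pCons 0 q" by simp
  then show ?thesis by (simp only: poly_matrix_add poly_matrix_smult) (simp add: vec.scale_minus_left)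
qed

text \<open>The vectors \<open>v, C v, \<dots>, C\<^sup>d v\<close> in dimension \<open>d\<close> cannot be independent.\<close>

lemma annihilating_poly_exists:
  fixes C :: "complex ^ 's ^ 's"
  obtains p where "p \<noteq> 0" "poly_matrix C p v = 0"
proof -
  have "\<exists>p. p \<noteq> 0 \<and> poly_matrix C p v = 0"
  proof (rule ccontr)
    assume "\<not> ?thesis"
    then have inj: "p = 0" if "poly_matrix C p v = 0" for p using that by blast
    define f where "f k = poly_matrix C (monom 1 k) v" for k
    have scale: "c *s f k = poly_matrix C (monom c k) v" for c k
      by (simp add: f_def smult_monom flip: poly_matrix_smult)
    have inj_f: "inj f"
    proof (rule injI)
      fix j k assume "f j = f k"
      then have "poly_matrix C (monom 1 j + monom (-1) k) v = 0"
        by (simp only: poly_matrix_add scale[symmetric]) simp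
      from inj[OF this] have "monom 1 j = (monom 1 k :: complex poly)"
        by (simp add: eq_neg_iff_add_eq_0 flip: minus_monom)
      then show "j = k" by (metis degree_monom_eq zero_neq_one)
    qed
    let ?S = "f ` {..CARD('s)}"
    have "vec.independent ?S"
      unfolding vec.dependent_finite[OF finite_imageI[OF finite_atMost]] not_ex
    proof (intro allI notI, elim conjE bexE)
      fix u w assume sum: "(\<Sum>w\<in>?S. u w *s w) = 0" and w: "u w \<noteq> 0" "w \<in> ?S"
      then obtain k where k: "u (f k) \<noteq> 0" "k \<le> CARD('s)" by auto
      have "(\<Sum>w\<in>?S. u w *s w) = poly_matrix C (\<Sum>k\<le>CARD('s). monom (u (f k)) k) v"
        by (simp add: sum.reindex inj_on_subset[OF inj_f] scale poly_matrix_sum)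
      with sum have "(\<Sum>k\<le>CARD('s). monom (u (f k)) k) = 0" using inj by simp
      then have "coeff (\<Sum>k\<le>CARD('s). monom (u (f k)) k) k = 0" by simp
      then show False using k by (simp add: coeff_sum)
    qed
    then have "card ?S \<le> CARD('s)"
      by (metis subset_UNIV vec.independent_card_le_dim vec_dim_card)
    then show False using card_image[OF inj_on_subset[OF inj_f], of "{..CARD('s)}"] by simp
  qed
  then show ?thesis using that by blast
qed

text \<open>
  If \<open>p(C) v = 0\<close> and \<open>p = (X - z) q\<close>, then either \<open>q(C) v\<close> is an eigenvector for \<open>z\<close>, or it
  vanishes and \<open>q\<close> has smaller degree than \<open>p\<close>.
\<close>

lemma eigenvector_exists:
  fixes C :: "complex ^ 's ^ 's"
  obtains z w where "w \<noteq> 0" "C *v w = z *s w"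
proof -
  let ?v = "axis undefined 1 :: complex ^ 's"
  have "\<exists>z w. w \<noteq> 0 \<and> C *v w = z *s w" if "p \<noteq> 0" "poly_matrix C p ?v = 0" for p
    using that
  proof (induction "degree p" arbitrary: p)
    case 0
    then obtain a where "p = [:a:]" "a \<noteq> 0" by (metis degree_0_id pCons_0_0)
    with 0 have "a *s ?v = 0" by simp
    with \<open>a \<noteq> 0\<close> show ?case by (simp add: axis_eq_0_iff)
  next
    case (Suc k)
    then have "\<not> constant (poly p)" by (simp add: constant_degree)
    then obtain z where "poly p z = 0" using fundamental_theorem_of_algebra by blast
    then obtain q where q: "p = [:-z, 1:] * q" by (metis dvdE poly_eq_0_iff_dvd)
    with Suc.prems have "q \<noteq> 0" by auto
    show ?case
    proof (cases "poly_matrix C q ?v = 0")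
      case True
      have "degree p = Suc (degree q)"
        unfolding q by (subst degree_mult_eq) (use \<open>q \<noteq> 0\<close> in auto)
      with Suc True \<open>q \<noteq> 0\<close> show ?thesis by auto
    next
      case False
      then show ?thesis using Suc.prems(2) unfolding q poly_matrix_root_factor by auto
    qed
  qed
  with annihilating_poly_exists that show ?thesis by metis
qed

subsection \<open>Complex conjugation\<close>

definition vec_cnj :: "complex ^ 's \<Rightarrow> complex ^ 's" where
  "vec_cnj s = (\<chi> i. cnj (s $ i))"

lemma vec_cnj_simps [simp]:
  "vec_cnj (vec_cnj s) = s" "vec_cnj (s + t) = vec_cnj s + vec_cnj t"
  "vec_cnj (c *s s) = cnj c *s vec_cnj s" "vec_cnj (r *\<^sub>R s) = r *\<^sub>R vec_cnj s"
  "vec_cnj (- s) = - vec_cnj s" "vec_cnj 0 = 0"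
  by (simp_all add: vec_cnj_def vec_eq_iff)

lemma bij_vec_cnj: "bij vec_cnj"
  by (rule o_bij[of vec_cnj]) auto

section \<open>The basis of the Clifford algebra\<close>

lemma cl_vec_axis: "cl_vec (axis i 1) = axis {i} 1"
  by (simp add: cl_vec_def axis_def if_distrib[where f = "\<lambda>r. r *\<^sub>R _"] cong: if_cong)

lemma linear_cl_vec: "linear cl_vec"
  unfolding cl_vec_def by (auto intro!: linearI simp: algebra_simps sum.distrib scaleR_sum_right)

lemma cl_vec_nth: "cl_vec v $ {i} = v $ i"
  by (simp add: cl_vec_def axis_def if_distrib cong: if_cong)

lemma cl_vec_square: "cl_mult (cl_vec v) (cl_vec v) = (- (v \<bullet> v)) *\<^sub>R cl_one"
proof -
  have "2 *\<^sub>R cl_mult (cl_vec v) (cl_vec v) = 2 *\<^sub>R ((- (v \<bullet> v)) *\<^sub>R cl_one)"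
    using cl_vec_polar[of v v] by (simp add: scaleR_2)
  then show ?thesis by (simp only: scaleR_cancel_left) simp
qed

lemma cl_sign_square [simp]: "cl_sign A B * cl_sign A B = 1"
  by (simp add: cl_sign_def flip: power_mult_distrib)

lemma axis_insert:
  assumes "i \<notin> A"
  shows "axis (insert i A) 1 = cl_sign {i} A *\<^sub>R cl_mult (axis {i} 1) (axis A 1)"
proof -
  have "sym_diff {i} A = insert i A" using assms by auto
  then show ?thesis by (simp add: cl_mult_axis)
qed

text \<open>
  The Clifford algebra is spanned by products of basis vectors.
\<close>

lemma cl_induct [case_names one vec add scale]:
  fixes x :: "'m::{finite,linorder} cl"
  assumes "P cl_one" and v: "\<And>i x. P x \<Longrightarrow> P (cl_mult (axis {i} 1) x)"
    and a: "\<And>x y. P x \<Longrightarrow> P y \<Longrightarrow> P (x + y)" and s: "\<And>r x. P x \<Longrightarrow> P (r *\<^sub>R x)"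
  shows "P x"
proof -
  have basis: "P (axis A 1)" for A :: "'m set"
  proof (rule finite_induct[OF finite[of A]])
    show "P (axis {} 1)" using assms(1) by (simp add: cl_one_def)
  next
    fix i and F :: "'m set"
    assume "i \<notin> F" "P (axis F 1)"
    then show "P (axis (insert i F) 1)" by (subst axis_insert) (auto intro: v s)
  qed
  have "P (\<Sum>A\<in>F. x $ A *\<^sub>R axis A 1)" if "finite F" for F
    using that
  proof induction
    case empty
    then show ?case using s[OF assms(1), of 0] by simp
  next
    case (insert A F)
    then show ?case by (simp add: a s basis)
  qed
  then show ?thesis by (subst cl_expand) simp
qed

text \<open>\<open>(-1)\<^bsup>k\<^esup> e\<^sub>A\<^sup>2 = (-1)\<^bsup>k + k(k+1)/2\<^esup>\<close> for \<open>k = |A|\<close>; this sign has period 4 in \<open>k\<close>.\<close>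

lemma cl_sign_self:
  "(-1) ^ card A * cl_sign A A = Re ((1 - \<i>) * \<i> ^ card A)"
  for A :: "'m::{finite,linorder} set"
proof -
  have step: "Re ((1 - \<i>) * \<i> ^ Suc k) = (-1) ^ k * Re ((1 - \<i>) * \<i> ^ k)" for k
    by (cases "even k") (auto elim!: evenE oddE simp: power_mult)
  show ?thesis
  proof (rule finite_induct[OF finite[of A]])
    show "(-1) ^ card {} * cl_sign {} ({}::'m set) = Re ((1 - \<i>) * \<i> ^ card ({}::'m set))"
      by (simp add: cl_sign_def)
  next
    fix a and F :: "'m set"
    assume "a \<notin> F" and IH: "(-1) ^ card F * cl_sign F F = Re ((1 - \<i>) * \<i> ^ card F)"
    have ins: "insert a F = sym_diff {a} F" using \<open>a \<notin> F\<close> by auto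
    have aa: "cl_sign {a} {a} = -1" by (simp add: cl_sign_prod)
    have "cl_sign {a} F * cl_sign F {a} = (\<Prod>b\<in>F. (if b \<le> a then -1 else 1) * (if a \<le> b then -1 else 1))"
      by (simp add: cl_sign_prod prod.distrib)
    also have "\<dots> = (\<Prod>b\<in>F. - 1)"
      using \<open>a \<notin> F\<close> by (intro prod.cong refl) auto
    finally have af: "cl_sign {a} F * cl_sign F {a} = (-1) ^ card F" by simp
    have "cl_sign (insert a F) (insert a F) =
        cl_sign {a} {a} * (cl_sign {a} F * cl_sign F {a}) * cl_sign F F"
      unfolding ins cl_sign_sym_diff by (simp add: ac_simps)
    then have "(-1) ^ card (insert a F) * cl_sign (insert a F) (insert a F) =
        (-1) ^ card F * ((-1) ^ card F * cl_sign F F)"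
      using \<open>a \<notin> F\<close> by (simp add: aa af)
    also have "\<dots> = Re ((1 - \<i>) * \<i> ^ card (insert a F))"
      unfolding IH using \<open>a \<notin> F\<close> by (simp only: step[symmetric]) simp
    finally show "(-1) ^ card (insert a F) * cl_sign (insert a F) (insert a F) =
        Re ((1 - \<i>) * \<i> ^ card (insert a F))" .
  qed
qed

lemma sum_power_card: "(\<Sum>A\<in>Pow F. z ^ card A) = (1 + z :: complex) ^ card F" if "finite F"
  using prod_add[OF that, of "\<lambda>_. z" "\<lambda>_. 1"] by (simp add: add.commute)

text \<open>
  The sum is the real part of \<open>(1 - \<i>) (1 + \<i>)\<^bsup>4n+2\<^esup>\<close>, and \<open>(1 + \<i>)\<^sup>2 = 2\<i>\<close>.
\<close>

lemma sum_cl_sign_self: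
  assumes "CARD('m::{finite,linorder}) = 4 * n + 2"
  shows "(\<Sum>A\<in>UNIV. (-1) ^ card A * cl_sign A (A::'m set)) = (-1) ^ n * 2 ^ (2 * n + 1)"
proof -
  have "(\<Sum>A\<in>UNIV. (-1) ^ card A * cl_sign A (A::'m set)) =
      Re ((1 - \<i>) * (\<Sum>A\<in>(UNIV :: 'm set set). \<i> ^ card A))"
    by (simp only: cl_sign_self sum_distrib_left Re_sum)
  also have "(\<Sum>A\<in>(UNIV :: 'm set set). \<i> ^ card A) = ((1 + \<i>)\<^sup>2) ^ (2 * n + 1)"
    using sum_power_card[OF finite[of "UNIV :: 'm set"], of \<i>] by (simp add: assms power_mult[symmetric] del: power_Suc)
  also have "(1 + \<i>)\<^sup>2 = 2 * \<i>" by (simp add: power2_eq_square algebra_simps)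
  also have "(2 * \<i>) ^ (2 * n + 1) = of_real ((-1) ^ n * 2 ^ (2 * n + 1)) * \<i>"
    using power_mult_distrib[of "-1" "4 :: complex" n] by (simp add: power_mult_distrib power_mult)
  also have "Re ((1 - \<i>) * (of_real ((-1) ^ n * 2 ^ (2 * n + 1)) * \<i>)) = (-1) ^ n * 2 ^ (2 * n + 1)"
  proof -
    have "Re ((1 - \<i>) * (of_real r * \<i>)) = r" for r :: real by simp
    then show ?thesis .
  qed
  finally show ?thesis .
qed

section \<open>The complex spinor module in dimension \<open>4n + 2\<close>\<close>

locale spinor_module =
  fixes \<rho> :: "'m::{finite,linorder} cl \<Rightarrow> complex ^ 's ^ 's" and n :: nat
  assumes module: "complex_spinor_module \<rho>" and dim: "CARD('m) = 4 * n + 2"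
begin

abbreviation \<gamma> :: "'m set \<Rightarrow> complex ^ 's ^ 's" where
  "\<gamma> A \<equiv> \<rho> (axis A 1)"

abbreviation \<gamma>v where
  "\<gamma>v v \<equiv> \<rho> (cl_vec v)"

lemma linear_rho: "linear \<rho>"
  using module by (simp add: complex_spinor_module_def)

lemmas rho_add = linear_add[OF linear_rho]
lemmas rho_scale = linear_scale[OF linear_rho]

lemma rho_one [simp]: "\<rho> cl_one = mat 1"
  using module by (simp add: complex_spinor_module_def)

lemma rho_mult: "\<rho> (cl_mult x y) = \<rho> x ** \<rho> y"
  using module by (simp add: complex_spinor_module_def)

lemma irreducible:
  assumes "vec.subspace W" "\<And>x s. s \<in> W \<Longrightarrow> \<rho> x *v s \<in> W"
  shows "W = {0} \<or> W = UNIV"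
  using module assms unfolding complex_spinor_module_def by blast

lemma linear_gammav: "linear \<gamma>v"
  using linear_compose[OF linear_cl_vec linear_rho] by (simp add: o_def)

lemma gamma_mult: "\<gamma> A ** \<gamma> B = cl_sign A B *\<^sub>R \<gamma> (sym_diff A B)"
  by (simp add: cl_mult_axis rho_scale flip: rho_mult)

lemma gamma_empty: "\<gamma> {} = mat 1"
  using rho_one by (simp add: cl_one_def)

lemma gammav_axis: "\<gamma>v (axis i 1) = \<gamma> {i}"
  by (simp add: cl_vec_axis)

lemma gammav_sum: "\<gamma>v v = (\<Sum>i\<in>UNIV. v $ i *\<^sub>R \<gamma> {i})"
  by (simp add: cl_vec_def linear_sum[OF linear_rho] rho_scale)

lemma gamma_square: "\<gamma> {i} ** \<gamma> {i} = - mat 1"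
  using gamma_mult[of "{i}" "{i}"] by (simp add: gamma_empty cl_sign_prod)

lemma gamma_swap: "\<gamma> {i} ** \<gamma> A = (-1) ^ card (A - {i}) *\<^sub>R (\<gamma> A ** \<gamma> {i})"
proof -
  have "cl_sign {i} A * cl_sign A {i} = (\<Prod>b\<in>A. (if b \<le> i then -1 else 1) * (if i \<le> b then -1 else 1))"
    by (simp add: cl_sign_prod prod.distrib)
  also have "\<dots> = (\<Prod>b\<in>A. if b = i then 1 else - 1)"
    by (intro prod.cong refl) auto
  also have "\<dots> = (-1) ^ card (A - {i})"
    by (simp add: prod.If_cases Diff_eq)
  finally have "cl_sign {i} A * cl_sign A {i} * cl_sign A {i} = (-1) ^ card (A - {i}) * cl_sign A {i}"
    by simp
  then have "cl_sign {i} A = (-1) ^ card (A - {i}) * cl_sign A {i}" by (simp add: mult.assoc)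
  moreover have "sym_diff A {i} = sym_diff {i} A" by auto
  ultimately show ?thesis by (simp add: gamma_mult)
qed

lemma gammav_square: "\<gamma>v v *v (\<gamma>v v *v s) = - ((v \<bullet> v) *\<^sub>R s)"
proof -
  have "\<gamma>v v ** \<gamma>v v = (- (v \<bullet> v)) *\<^sub>R mat 1"
    by (simp only: rho_mult[symmetric] cl_vec_square rho_scale rho_one)
  then show ?thesis by (simp only: matrix_vector_mul_assoc matrix_vector_scaleR) simp
qed

lemma card_UNIV_even: "even CARD('m)" by (simp add: dim)

subsection \<open>Clifford multiplication is skew-adjoint\<close>

lemma norm_gammav: "norm (\<gamma>v v *v s) = norm v * norm s"
proof (cases "v = 0")
  case True
  then show ?thesis by (simp add: linear_0[OF linear_gammav])
next
  case False
  then have "norm (\<gamma>v ((1 / norm v) *\<^sub>R v) *v s) = norm s"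
    using module unfolding complex_spinor_module_def by simp
  with False show ?thesis
    by (simp add: linear_scale[OF linear_gammav] matrix_vector_scaleR field_simps)
qed

text \<open>
  Polarization of \<open>norm_gammav\<close>.
\<close>

lemma inner_gammav: "(\<gamma>v v *v s) \<bullet> (\<gamma>v v *v t) = (v \<bullet> v) * (s \<bullet> t)"
proof -
  have n2: "(norm (\<gamma>v v *v s))\<^sup>2 = (v \<bullet> v) * (norm s)\<^sup>2" for s
    unfolding norm_gammav by (simp add: power_mult_distrib power2_norm_eq_inner)
  have "(\<gamma>v v *v s) \<bullet> (\<gamma>v v *v t) =
      ((v \<bullet> v) * (norm (s + t))\<^sup>2 - (v \<bullet> v) * (norm s)\<^sup>2 - (v \<bullet> v) * (norm t)\<^sup>2) / 2"
    by (simp only: dot_norm[of "\<gamma>v v *v s"] n2 flip: matrix_vector_right_distrib)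
  then show ?thesis by (simp only: dot_norm[of s t]) (simp add: algebra_simps)
qed

text \<open>
  By \<open>inner_gammav\<close> a unit vector acts isometrically, and its square is \<open>-1\<close>; so its adjoint is its
  negative.
\<close>

lemma gammav_skew: "(\<gamma>v v *v s) \<bullet> t = - (s \<bullet> (\<gamma>v v *v t))"
proof (cases "v = 0")
  case True
  then show ?thesis by (simp add: linear_0[OF linear_gammav])
next
  case False
  have "(\<gamma>v v *v s) \<bullet> (\<gamma>v v *v (\<gamma>v v *v t)) = (v \<bullet> v) * (s \<bullet> (\<gamma>v v *v t))"
    by (rule inner_gammav)
  then have "(v \<bullet> v) * ((\<gamma>v v *v s) \<bullet> t) = (v \<bullet> v) * - (s \<bullet> (\<gamma>v v *v t))"
    by (simp add: gammav_square)
  with False show ?thesis by (simp only: mult_cancel_left inner_eq_zero_iff) simp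
qed

lemma matrix_vector_axis: "(M *v axis k z) $ j = M $ j $ k * (z::complex)"
  by (simp add: matrix_vector_mult_def axis_def if_distrib cong: if_cong)

text \<open>
  The inner product is only the real part of the Hermitian product; testing skewness on \<open>z = 1\<close> and
  on \<open>z = \<i>\<close> recovers the full matrix identity.
\<close>

lemma gammav_hermitian: "\<gamma>v v $ j $ k = - cnj (\<gamma>v v $ k $ j)"
proof -
  have e: "(\<gamma>v v $ j $ k * z) \<bullet> (1::complex) = - (z \<bullet> (\<gamma>v v $ k $ j))" for z
    using gammav_skew[of v "axis k z" "axis j 1"]
    by (simp add: inner_axis inner_axis' matrix_vector_axis)
  show ?thesis using e[of 1] e[of \<i>] by (simp add: complex_eq_iff inner_complex_def)
qed

lemma vec_cnj_gammav: "vec_cnj (\<gamma>v v *v s) = - (transpose (\<gamma>v v) *v vec_cnj s)"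
proof -
  have "cnj (\<gamma>v v $ i $ j) = - \<gamma>v v $ j $ i" for i j
    by (subst (2) gammav_hermitian) simp
  then show ?thesis
    by (simp add: vec_eq_iff vec_cnj_def matrix_vector_mult_def transpose_def sum_negf)
qed

subsection \<open>The intertwiners of \<open>\<rho>\<close> with its transpose\<close>

text \<open>
  This is the condition on \<open>A\<close> under which the antilinear map that sends \<open>s\<close> to \<open>A\<close> times the
  conjugate of \<open>s\<close> anticommutes with vectors; see \<open>vec_cnj_gammav\<close>.
\<close>

definition intertwiner :: "complex ^ 's ^ 's \<Rightarrow> bool" where
  "intertwiner A \<longleftrightarrow> (\<forall>i. \<gamma> {i} ** A = A ** transpose (\<gamma> {i}))"

lemma intertwiner_gammav:
  assumes "intertwiner A"
  shows "\<gamma>v v ** A = A ** transpose (\<gamma>v v)"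
proof -
  have "transpose (\<gamma>v v) = (\<Sum>i\<in>UNIV. v $ i *\<^sub>R transpose (\<gamma> {i}))"
    by (simp add: gammav_sum vec_eq_iff transpose_def)
  then show ?thesis
    using assms unfolding intertwiner_def
    by (simp add: gammav_sum matrix_mult_sum_left matrix_mult_sum_right matrix_mult_scaleR)
qed

lemma intertwiner_transpose: "intertwiner A \<Longrightarrow> intertwiner (transpose A)"
  unfolding intertwiner_def by (metis matrix_transpose_mul transpose_transpose)

lemma invariant_subspace:
  assumes "vec.subspace W" "\<And>i s. s \<in> W \<Longrightarrow> \<gamma> {i} *v s \<in> W"
  shows "W = {0} \<or> W = UNIV"
proof (rule irreducible[OF assms(1)])
  fix x s assume "s \<in> W"
  then show "\<rho> x *v s \<in> W"
  proof (induction x arbitrary: s rule: cl_induct)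
    case (vec i x)
    then show ?case using assms(2) by (simp add: rho_mult flip: matrix_vector_mul_assoc)
  next
    case (add x y)
    then show ?case
      by (simp add: rho_add matrix_vector_mult_add_rdistrib vec.subspace_add[OF assms(1)])
  next
    case (scale r x)
    then show ?case
      by (simp add: rho_scale matrix_vector_scaleR vector_scaleR_eq vec.subspace_scale[OF assms(1)])
  qed simp
qed

text \<open>
  The first half of Schur's lemma: the range of an intertwiner is an invariant subspace.
\<close>

lemma intertwiner_invertible:
  assumes "intertwiner A" "A \<noteq> 0"
  shows "invertible A"
proof -
  have "vec.subspace (range ((*v) A))"
    using vec.subspace_image[of UNIV A] by simp
  moreover have "\<gamma> {i} *v s \<in> range ((*v) A)" if s: "s \<in> range ((*v) A)" for i s
  proof -
    from s obtain t where "s = A *v t" by auto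
    then have "\<gamma> {i} *v s = A *v (transpose (\<gamma> {i}) *v t)"
      using assms(1) by (simp add: intertwiner_def matrix_vector_mul_assoc del: transpose_matrix_vector)
    then show ?thesis by auto
  qed
  ultimately have "range ((*v) A) = {0} \<or> range ((*v) A) = UNIV"
    by (rule invariant_subspace)
  moreover have "range ((*v) A) \<noteq> {0}"
  proof
    assume "range ((*v) A) = {0}"
    then have "A *v x = 0 *v x" for x by auto
    then show False using assms(2) by (simp only: matrix_eq) simp
  qed
  ultimately have "surj ((*v) A)" by simp
  then show ?thesis
    using matrix_right_invertible_surjective[of A] invertible_right_inverse by auto
qed

text \<open>
  The second half of Schur's lemma: an eigenspace of a commuting matrix is an invariant subspace.
\<close>

lemma commutant_scalar:
  assumes "\<And>i. \<gamma> {i} ** C = C ** \<gamma> {i}"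
  obtains z where "\<And>s. C *v s = z *s s"
proof -
  obtain z w where w: "w \<noteq> 0" "C *v w = z *s w" by (rule eigenvector_exists)
  let ?W = "{s. C *v s = z *s s}"
  have "vec.subspace ?W"
    by (rule vec.subspaceI)
       (simp_all add: matrix_vector_right_distrib vec.scale_right_distrib vector_scalar_commute
          vec.scale_left_commute)
  moreover have "\<gamma> {i} *v s \<in> ?W" if "s \<in> ?W" for i s
  proof -
    have "C *v (\<gamma> {i} *v s) = \<gamma> {i} *v (C *v s)"
      by (simp add: matrix_vector_mul_assoc assms)
    with that show ?thesis by (simp add: vector_scalar_commute)
  qed
  ultimately have "?W = {0} \<or> ?W = UNIV" by (rule invariant_subspace)
  with w have "?W = UNIV" by auto
  then show ?thesis using that by blast
qed

text \<open>
  If \<open>A\<close> and \<open>B\<close> are intertwiners, then \<open>B A\<^sup>-\<^sup>1\<close> commutes with the Clifford action.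
\<close>

lemma intertwiner_unique:
  assumes "intertwiner A" "A \<noteq> 0" "intertwiner B"
  obtains z where "\<And>s. B *v s = z *s (A *v s)"
proof -
  from intertwiner_invertible[OF assms(1,2)] obtain A' where A': "A ** A' = mat 1" "A' ** A = mat 1"
    unfolding invertible_def by blast
  have comm: "\<gamma> {i} ** (B ** A') = (B ** A') ** \<gamma> {i}" for i
  proof -
    have "transpose (\<gamma> {i}) ** A' = A' ** (A ** transpose (\<gamma> {i})) ** A'"
      using A' by (simp add: matrix_mul_assoc)
    also have "\<dots> = A' ** (\<gamma> {i} ** A) ** A'" using assms(1) by (simp add: intertwiner_def)
    also have "\<dots> = A' ** \<gamma> {i}" using A' by (simp flip: matrix_mul_assoc)
    finally have *: "transpose (\<gamma> {i}) ** A' = A' ** \<gamma> {i}" .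
    have "\<gamma> {i} ** (B ** A') = (\<gamma> {i} ** B) ** A'" by (simp add: matrix_mul_assoc)
    also have "\<dots> = B ** (transpose (\<gamma> {i}) ** A')"
      using assms(3) by (simp add: intertwiner_def matrix_mul_assoc)
    also have "\<dots> = (B ** A') ** \<gamma> {i}" by (simp add: * matrix_mul_assoc)
    finally show ?thesis .
  qed
  obtain z where z: "\<And>s. (B ** A') *v s = z *s s" using commutant_scalar[OF comm] by blast
  have "B *v s = z *s (A *v s)" for s
    using z[of "A *v s"] A'(2) by (simp add: matrix_vector_mul_assoc flip: matrix_mul_assoc)
  then show ?thesis by (rule that)
qed

subsection \<open>Averaging\<close>

text \<open>
  The projection, up to a factor, onto the intertwiners. An intertwiner is a fixed point of
  \<open>B \<mapsto> - \<gamma>(v) B \<gamma>(v)\<^sup>T\<close> for unit vectors \<open>v\<close>, because \<open>\<gamma>(v)\<^sup>2 = -1\<close>; hence the signs \<open>(-1)\<^bsup>|A|\<^esup>\<close>.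
\<close>

definition average :: "complex ^ 's ^ 's \<Rightarrow> complex ^ 's ^ 's" where
  "average B = (\<Sum>A\<in>UNIV. (-1) ^ card A *\<^sub>R (\<gamma> A ** B ** transpose (\<gamma> A)))"

text \<open>
  Multiplication by \<open>e\<^sub>i\<close> permutes the basis \<open>e\<^sub>A\<close> up to signs, which occur twice in each
  summand and cancel, and it changes the parity of \<open>|A|\<close>.
\<close>

lemma intertwiner_average: "intertwiner (average B)"
  unfolding intertwiner_def
proof
  fix i
  let ?R = "\<gamma> {i}" and ?f = "\<lambda>A. (-1) ^ card A *\<^sub>R (\<gamma> A ** B ** transpose (\<gamma> A))"
  have flip: "(-1) ^ card A = - ((-1) ^ card (sym_diff {i} A) :: real)" for A
  proof (cases "i \<in> A")
    case True
    then have "sym_diff {i} A = A - {i}" by auto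
    with card.remove[OF finite True] show ?thesis by simp
  next
    case False
    then have "sym_diff {i} A = insert i A" by auto
    with False show ?thesis by simp
  qed
  have "?R ** ?f A ** transpose ?R = - ?f (sym_diff {i} A)" for A
  proof -
    have "?R ** ?f A ** transpose ?R =
        (-1) ^ card A *\<^sub>R ((?R ** \<gamma> A) ** B ** transpose (?R ** \<gamma> A))"
      by (simp add: matrix_mult_scaleR matrix_transpose_mul matrix_mul_assoc)
    also have "\<dots> = - ?f (sym_diff {i} A)"
      unfolding gamma_mult transpose_scaleR matrix_mult_scaleR flip[of A] by simp
    finally show ?thesis .
  qed
  then have "?R ** average B ** transpose ?R = - (\<Sum>A\<in>UNIV. ?f (sym_diff {i} A))"
    by (simp add: average_def matrix_mult_sum_left matrix_mult_sum_right sum_negf)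
  also have "(\<Sum>A\<in>UNIV. ?f (sym_diff {i} A)) = average B"
    unfolding average_def
    by (rule sum.reindex_bij_witness[of _ "sym_diff {i}" "sym_diff {i}"]) auto
  finally have "?R ** average B ** (transpose ?R ** transpose ?R) = - average B ** transpose ?R"
    by (simp add: matrix_mul_assoc)
  moreover have "transpose ?R ** transpose ?R = - mat 1"
    by (simp add: gamma_square flip: matrix_transpose_mul)
       (simp add: transpose_def mat_def vec_eq_iff)
  moreover have neg: "M ** (- N) = - (M ** N)" "(- M) ** N = - (M ** N)" for M N :: "complex ^ 's ^ 's"
    using matrix_mult_scaleR(1)[of "-1" M N] matrix_mult_scaleR(2)[of M "-1" N] by simp_all
  ultimately show "?R ** average B = average B ** transpose ?R" by simp
qed

definition matrix_unit :: "'s \<Rightarrow> 's \<Rightarrow> complex ^ 's ^ 's" where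
  "matrix_unit i j = (\<chi> p q. if p = i \<and> q = j then 1 else 0)"

lemma average_unit_nth:
  "average (matrix_unit i j) $ k $ l = (\<Sum>A\<in>UNIV. (-1) ^ card A *\<^sub>R (\<gamma> A $ k $ i * \<gamma> A $ l $ j))"
proof -
  have "(M ** matrix_unit i j ** transpose N) $ k $ l = M $ k $ i * N $ l $ j" for M N
  proof -
    have "(M ** matrix_unit i j) $ k $ q = (if q = j then M $ k $ i else 0)" for q
      by (auto simp: matrix_matrix_mult_def matrix_unit_def if_distrib cong: if_cong)
    then show ?thesis
      by (subst matrix_matrix_mult_def)
         (simp add: transpose_def if_distrib[where f = "\<lambda>x. x * _"] cong: if_cong)
  qed
  then show ?thesis by (simp add: average_def)
qed

text \<open>
  For nonempty \<open>A\<close> some \<open>e\<^sub>i\<close> anticommutes with \<open>e\<^sub>A\<close>: one with \<open>i \<in> A\<close> if \<open>|A|\<close> is even, and one with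
  \<open>i \<notin> A\<close> if \<open>|A|\<close> is odd, which exists because \<open>m\<close> is even. Conjugation by it shows that the trace
  equals its negative.
\<close>

lemma trace_gamma: "trace (\<gamma> A) = (if A = {} then of_nat CARD('s) else 0)"
proof (cases "A = {}")
  case True
  then show ?thesis by (simp add: gamma_empty trace_def mat_def)
next
  case False
  obtain i where "i \<in> A \<longleftrightarrow> even (card A)"
  proof (cases "even (card A)")
    case True
    with False that show ?thesis by blast
  next
    case odd: False
    then have "A \<noteq> UNIV" using card_UNIV_even by auto
    with odd that show ?thesis by blast
  qed
  then have "odd (card (A - {i}))"
    by (cases "i \<in> A") (auto simp: card_Diff_singleton card_gt_0_iff False)
  then have anti: "\<gamma> {i} ** \<gamma> A = - (\<gamma> A ** \<gamma> {i})" by (simp add: gamma_swap)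
  have "trace (\<gamma> {i} ** (\<gamma> A ** \<gamma> {i})) = trace (\<gamma> A ** (\<gamma> {i} ** \<gamma> {i}))"
    by (subst trace_mul_sym) (simp add: matrix_mul_assoc)
  moreover have "\<gamma> {i} ** (\<gamma> A ** \<gamma> {i}) = - (\<gamma> A ** (\<gamma> {i} ** \<gamma> {i}))"
    using matrix_mult_scaleR(1)[of "-1" "\<gamma> A ** \<gamma> {i}" "\<gamma> {i}"] by (simp add: matrix_mul_assoc anti)
  moreover have "trace (- M) = - trace M" for M :: "complex ^ 's ^ 's"
    by (simp add: trace_def sum_negf)
  ultimately have "trace (\<gamma> A ** (\<gamma> {i} ** \<gamma> {i})) = 0" by simp
  moreover have "\<gamma> A ** (\<gamma> {i} ** \<gamma> {i}) = - \<gamma> A"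
    using matrix_mult_scaleR(2)[of "\<gamma> A" "-1" "mat 1"] by (simp add: gamma_square)
  ultimately show ?thesis using False by (simp add: trace_def sum_negf)
qed

text \<open>
  The left-hand side is the trace of the operator \<open>B \<mapsto> average B\<close> on matrices.
\<close>

lemma trace_average:
  "(\<Sum>i\<in>UNIV. \<Sum>j\<in>UNIV. average (matrix_unit i j) $ i $ j) = (of_nat CARD('s))\<^sup>2"
proof -
  have "(\<Sum>i\<in>UNIV. \<Sum>j\<in>UNIV. average (matrix_unit i j) $ i $ j) =
      (\<Sum>A\<in>UNIV. (-1) ^ card A *\<^sub>R (trace (\<gamma> A) * trace (\<gamma> A)))"
    by (simp add: average_unit_nth sum.swap[of _ "UNIV :: 'm set set"] trace_def sum_product scaleR_sum_right)
  also have "\<dots> = (\<Sum>A\<in>(UNIV :: 'm set set). if A = {} then (of_nat CARD('s))\<^sup>2 else 0)"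
    by (rule sum.cong) (auto simp: trace_gamma power2_eq_square)
  finally show ?thesis by simp
qed

text \<open>
  The left-hand side is the trace of the operator \<open>B \<mapsto> (average B)\<^sup>T\<close> on matrices.
\<close>

lemma trace_transpose_average:
  "(\<Sum>i\<in>UNIV. \<Sum>j\<in>UNIV. average (matrix_unit i j) $ j $ i) =
     of_real ((-1) ^ n * 2 ^ (2 * n + 1)) * of_nat CARD('s)"
proof -
  have "trace (r *\<^sub>R M) = of_real r * trace M" for r and M :: "complex ^ 's ^ 's"
    by (simp add: trace_def sum_distrib_left) (simp add: scaleR_conv_of_real)
  then have tr: "trace (\<gamma> A ** \<gamma> A) = of_real (cl_sign A A) * of_nat CARD('s)" for A
    using trace_gamma[of "{}"] by (simp add: gamma_mult)
  have "(\<Sum>i\<in>UNIV. \<Sum>j\<in>UNIV. average (matrix_unit i j) $ j $ i) =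
      (\<Sum>A\<in>UNIV. (-1) ^ card A *\<^sub>R trace (\<gamma> A ** \<gamma> A))"
    by (simp add: average_unit_nth sum.swap[of _ "UNIV :: 'm set set"] trace_def matrix_matrix_mult_def
        scaleR_sum_right mult.commute)
  also have "\<dots> = of_real (\<Sum>A\<in>UNIV. (-1) ^ card A * cl_sign A (A :: 'm set)) * of_nat CARD('s)"
    by (simp add: tr scaleR_conv_of_real sum_distrib_right mult.assoc)
  finally show ?thesis by (simp only: sum_cl_sign_self[OF dim])
qed

text \<open>
  All averages are multiples of one intertwiner \<open>A\<close> with \<open>A\<^sup>T = z A\<close>, where \<open>z\<^sup>2 = 1\<close>. So the two
  traces above differ by the factor \<open>z\<close>, and their signs determine it.
\<close>

lemma intertwiner_exists:
  obtains A where "intertwiner A" "A \<noteq> 0" "transpose A = (-1) ^ n *\<^sub>R A"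
proof -
  let ?P = "\<lambda>i j. average (matrix_unit i j)"
  obtain i j where ij: "?P i j \<noteq> 0"
  proof -
    have "(\<Sum>i\<in>UNIV. \<Sum>j\<in>UNIV. ?P i j $ i $ j) \<noteq> 0" unfolding trace_average by simp
    then have "\<exists>i j. ?P i j \<noteq> 0" by (metis (no_types, lifting) sum.neutral zero_index)
    then show ?thesis using that by blast
  qed
  define A where "A = ?P i j"
  have A: "intertwiner A" "A \<noteq> 0" using ij by (simp_all add: A_def intertwiner_average)
  have nth_eq: "M $ k $ l = z * A $ k $ l" if "\<And>s. M *v s = z *s (A *v s)" for M z k l
    using arg_cong[OF that[of "axis l 1"], of "\<lambda>w. w $ k"] by (simp add: matrix_vector_axis)
  obtain z where z: "\<And>s. transpose A *v s = z *s (A *v s)"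
    using intertwiner_unique[OF A intertwiner_transpose[OF A(1)]] by blast
  have z1: "A $ l $ k = z * A $ k $ l" for k l
    using nth_eq[OF z, of k l] by (simp add: transpose_def)
  have z2: "average (matrix_unit i j) $ l $ k = z * average (matrix_unit i j) $ k $ l" for i j k l
  proof -
    obtain w where "\<And>s. ?P i j *v s = w *s (A *v s)"
      using intertwiner_unique[OF A intertwiner_average] by blast
    from nth_eq[OF this] show ?thesis using z1[of l k] by simp
  qed
  have "of_real ((-1) ^ n * 2 ^ (2 * n + 1)) * of_nat CARD('s) = z * (of_nat CARD('s))\<^sup>2"
    unfolding trace_average[symmetric] trace_transpose_average[symmetric] sum_distrib_left
    by (intro sum.cong refl z2)
  then have zd: "of_real ((-1) ^ n * 2 ^ (2 * n + 1)) = z * of_nat CARD('s)"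
    by (simp add: power2_eq_square)
  obtain k l where "A $ k $ l \<noteq> 0" using A(2) by (auto simp: vec_eq_iff)
  with z1[of k l] z1[of l k] have "z * z = 1" by simp
  then have "z = 1 \<or> z = - 1" by (simp add: square_eq_1_iff)
  then have "z = (-1) ^ n"
  proof
    assume "z = 1"
    then have "(-1) ^ n * 2 ^ (2 * n + 1) = real CARD('s)"
      using zd by (metis mult_1 of_real_eq_iff of_real_of_nat_eq)
    moreover have "\<not> odd n"
    proof
      assume "odd n"
      then have "(-1) ^ n * 2 ^ (2 * n + 1) < (0::real)" by simp
      with calculation show False by linarith
    qed
    ultimately show ?thesis using \<open>z = 1\<close> by simp
  next
    assume "z = - 1"
    then have "(-1) ^ n * 2 ^ (2 * n + 1) = - real CARD('s)"
      using zd by (metis mult_minus1 of_real_eq_iff of_real_minus of_real_of_nat_eq)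
    moreover have "\<not> even n"
    proof
      assume "even n"
      then have "(-1) ^ n * 2 ^ (2 * n + 1) > (0::real)" by simp
      with calculation show False by linarith
    qed
    ultimately show ?thesis using \<open>z = - 1\<close> by simp
  qed
  then have "transpose A $ k $ l = ((-1) ^ n *\<^sub>R A) $ k $ l" for k l
    using z1[of k l] by (simp add: transpose_def) (simp add: scaleR_conv_of_real)
  then have "transpose A = (-1) ^ n *\<^sub>R A" by (simp only: vec_eq_iff) simp
  with A that show ?thesis by blast
qed

end

context spinor_module
begin

subsection \<open>Charge conjugation\<close>

definition conj_matrix :: "complex ^ 's ^ 's" where
  "conj_matrix = (SOME A. intertwiner A \<and> A \<noteq> 0 \<and> transpose A = (-1) ^ n *\<^sub>R A)"

lemma conj_matrix:
  "intertwiner conj_matrix" "conj_matrix \<noteq> 0" "transpose conj_matrix = (-1) ^ n *\<^sub>R conj_matrix"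
proof -
  have "\<exists>A. intertwiner A \<and> A \<noteq> 0 \<and> transpose A = (-1) ^ n *\<^sub>R A"
    using intertwiner_exists by blast
  from someI_ex[OF this] show "intertwiner conj_matrix" "conj_matrix \<noteq> 0"
      "transpose conj_matrix = (-1) ^ n *\<^sub>R conj_matrix"
    by (auto simp: conj_matrix_def)
qed

text \<open>
  Up to complex multiples this is the only antilinear map that anticommutes with Clifford
  multiplication by vectors; it also anticommutes with the grading.
\<close>

definition charge_conj :: "complex ^ 's \<Rightarrow> complex ^ 's" where
  "charge_conj s = conj_matrix *v vec_cnj s"

lemma charge_conj_add: "charge_conj (s + t) = charge_conj s + charge_conj t"
  by (simp add: charge_conj_def matrix_vector_right_distrib)

lemma charge_conj_scale: "charge_conj (c *s s) = cnj c *s charge_conj s"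
  by (simp add: charge_conj_def vector_scalar_commute)

lemma charge_conj_scaleR: "charge_conj (r *\<^sub>R s) = r *\<^sub>R charge_conj s"
  by (simp add: charge_conj_def matrix_vector_scaleR)

lemma charge_conj_minus: "charge_conj (- s) = - charge_conj s"
  using charge_conj_scaleR[of "-1" s] by simp

lemma bounded_linear_charge_conj: "bounded_linear charge_conj"
  by (rule linear_conv_bounded_linear[THEN iffD1], rule linearI)
     (simp_all add: charge_conj_add charge_conj_scaleR)

lemma charge_conj_gammav: "charge_conj (\<gamma>v v *v s) = - (\<gamma>v v *v charge_conj s)"
  using matrix_mult_scaleR(2)[of conj_matrix "-1"]
  by (simp add: charge_conj_def vec_cnj_gammav matrix_vector_mul_assoc intertwiner_gammav[OF conj_matrix(1)]
      vec.neg del: transpose_matrix_vector)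

lemma bij_charge_conj: "bij charge_conj"
proof -
  have "invertible conj_matrix" using intertwiner_invertible conj_matrix by blast
  then have "bij ((*v) conj_matrix)"
    by (metis bij_def inj_matrix_vector_mult invertible_def matrix_right_invertible_surjective)
  then show ?thesis unfolding charge_conj_def[abs_def]
    using bij_comp[OF bij_vec_cnj] by (simp add: o_def)
qed

lemma charge_conj_0_iff [simp]: "charge_conj s = 0 \<longleftrightarrow> s = 0"
  by (metis bij_charge_conj bij_is_inj charge_conj_scaleR injD scale_zero_left)

text \<open>
  The real inner product of \<open>A s'\<close> and \<open>t\<close>, where \<open>s'\<close> is the conjugate of \<open>s\<close>, is the real part of a
  complex bilinear expression in \<open>s\<close> and \<open>t\<close> whose matrix is the conjugate of \<open>A\<close>. It is symmetric or
  skew together with \<open>A\<close>.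
\<close>

lemma charge_conj_adjoint: "charge_conj s \<bullet> t = (-1) ^ n * (s \<bullet> charge_conj t)"
proof -
  have sym: "conj_matrix $ i $ j = (-1) ^ n *\<^sub>R conj_matrix $ j $ i" for i j
    using arg_cong[OF conj_matrix(3), of "\<lambda>M. M $ j $ i"] by (simp add: transpose_def)
  have ic: "x \<bullet> y = Re (cnj x * y)" for x y by (simp add: inner_complex_def)
  have "charge_conj s \<bullet> t =
      Re (\<Sum>i\<in>UNIV. \<Sum>j\<in>UNIV. cnj (conj_matrix $ i $ j) * s $ j * t $ i)"
    by (simp add: charge_conj_def inner_vec_def ic matrix_vector_mult_def vec_cnj_def sum_distrib_right)
  also have "\<dots> = Re (\<Sum>j\<in>UNIV. \<Sum>i\<in>UNIV. cnj (conj_matrix $ i $ j) * s $ j * t $ i)"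
    by (subst sum.swap) simp
  also have "\<dots> = Re (\<Sum>j\<in>UNIV. \<Sum>i\<in>UNIV. (-1) ^ n *\<^sub>R (cnj (conj_matrix $ j $ i) * s $ j * t $ i))"
    by (subst sym) simp
  also have "\<dots> = (-1) ^ n * Re (\<Sum>j\<in>UNIV. \<Sum>i\<in>UNIV. cnj (cnj (s $ j) * (conj_matrix $ j $ i * cnj (t $ i))))"
    by (simp add: scaleR_sum_right[symmetric] algebra_simps)
  also have "Re (\<Sum>j\<in>UNIV. \<Sum>i\<in>UNIV. cnj (cnj (s $ j) * (conj_matrix $ j $ i * cnj (t $ i)))) =
      s \<bullet> charge_conj t"
    by (simp add: charge_conj_def inner_vec_def ic matrix_vector_mult_def vec_cnj_def sum_distrib_left algebra_simps)
  finally show ?thesis .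
qed

subsection \<open>The volume element\<close>

lemma gamma_anticommute:
  assumes sc: "\<And>r s. T (r *\<^sub>R s) = r *\<^sub>R T s"
    and anti: "\<And>i s. T (\<gamma> {i} *v s) = - (\<gamma> {i} *v T s)"
  shows "T (\<gamma> A *v s) = (-1) ^ card A *\<^sub>R (\<gamma> A *v T s)"
proof (rule finite_induct[OF finite[of A]])
  show "T (\<gamma> {} *v s) = (-1) ^ card ({}::'m set) *\<^sub>R (\<gamma> {} *v T s)" by (simp add: gamma_empty)
next
  fix i and F :: "'m set"
  assume i: "i \<notin> F" and IH: "T (\<gamma> F *v s) = (-1) ^ card F *\<^sub>R (\<gamma> F *v T s)"
  have ins: "\<gamma> (insert i F) *v s = cl_sign {i} F *\<^sub>R (\<gamma> {i} *v (\<gamma> F *v s))" for s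
    by (subst axis_insert[OF i])
       (simp add: rho_scale rho_mult matrix_vector_scaleR matrix_vector_mul_assoc)
  show "T (\<gamma> (insert i F) *v s) = (-1) ^ card (insert i F) *\<^sub>R (\<gamma> (insert i F) *v T s)"
    unfolding ins sc anti IH using i by (simp add: matrix_vector_scaleR)
qed

lemma gamma_UNIV_square: "\<gamma> UNIV *v (\<gamma> UNIV *v s) = - s"
proof -
  have "(-1) ^ card (UNIV :: 'm set) * cl_sign UNIV (UNIV :: 'm set) = - 1"
    unfolding cl_sign_self by (simp add: dim power_add power_mult)
  then have "cl_sign UNIV (UNIV :: 'm set) = - 1" by (simp add: dim power_add power_mult)
  then have "\<gamma> UNIV ** \<gamma> UNIV = (-1) *\<^sub>R mat 1"
    using gamma_mult[of UNIV UNIV] by (simp add: gamma_empty)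
  then show ?thesis by (simp only: matrix_vector_mul_assoc matrix_vector_scaleR) simp
qed

lemma volume_action: "volume_action \<rho> s = (-1) ^ n *\<^sub>R (\<i> *s (\<gamma> UNIV *v s))"
  by (simp add: volume_action_def dim power_mult vector_scaleR_eq vector_smult_assoc)

lemma volume_action_add: "volume_action \<rho> (s + t) = volume_action \<rho> s + volume_action \<rho> t"
  by (simp add: volume_action matrix_vector_right_distrib vec.scale_right_distrib scaleR_add_right)

lemma volume_action_scale: "volume_action \<rho> (c *s s) = c *s volume_action \<rho> s"
  by (simp add: volume_action vector_scalar_commute vector_scaleR_eq vec.scale_left_commute)

lemma volume_action_scaleR: "volume_action \<rho> (r *\<^sub>R s) = r *\<^sub>R volume_action \<rho> s"
  by (simp add: vector_scaleR_eq volume_action_scale)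

lemma volume_action_square [simp]: "volume_action \<rho> (volume_action \<rho> s) = s"
proof -
  have "(-1) ^ n * (\<i> * ((-1) ^ n * \<i>)) = (-1) ^ n * (-1) ^ n * (\<i> * \<i>)" by (simp only: ac_simps)
  also have "\<dots> = -1" by (simp flip: power_mult_distrib)
  finally have "((-1) ^ n * (\<i> * ((-1) ^ n * \<i>))) *s (\<gamma> UNIV *v (\<gamma> UNIV *v s)) = s"
    by (simp add: gamma_UNIV_square)
  then show ?thesis
    by (simp add: volume_action vector_scalar_commute vector_scaleR_eq vector_smult_assoc mult.assoc)
qed

text \<open>
  The spinor module is the direct sum of the \<open>\<plusminus>1\<close> eigenspaces of the complex volume element, with
  components \<open>(s \<plusminus> vol s) / 2\<close>.
\<close>

lemma odd_anticommutes_volume: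
  assumes add: "\<And>s t. T (s + t) = T s + T t" and sc: "\<And>r s. T (r *\<^sub>R s) = r *\<^sub>R T s"
    and "T ` spinors0 \<rho> \<subseteq> spinors1 \<rho>" "T ` spinors1 \<rho> \<subseteq> spinors0 \<rho>"
  shows "T (volume_action \<rho> s) = - volume_action \<rho> (T s)"
proof -
  define p q where "p = (1/2) *\<^sub>R (s + volume_action \<rho> s)" and "q = (1/2) *\<^sub>R (s + (-1) *\<^sub>R volume_action \<rho> s)"
  have "p + q = (1/2) *\<^sub>R s + (1/2) *\<^sub>R s" by (simp add: p_def q_def algebra_simps)
  then have s: "s = p + q" by (simp flip: scaleR_add_left)
  have "p \<in> spinors0 \<rho>"
    by (simp add: p_def spinors0_def volume_action_add volume_action_scaleR add.commute)
  moreover have "q \<in> spinors1 \<rho>"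
    unfolding q_def spinors1_def mem_Collect_eq volume_action_add volume_action_scaleR by (simp add: algebra_simps)
  ultimately have v: "volume_action \<rho> p = p" "volume_action \<rho> q = - q"
      "volume_action \<rho> (T p) = - T p" "volume_action \<rho> (T q) = T q"
    using assms(3,4) by (auto simp: spinors0_def spinors1_def)
  have "T (- q) = - T q" using sc[of "-1" q] by simp
  then show ?thesis unfolding s volume_action_add add v by simp
qed

lemma charge_conj_odd:
  "s \<in> spinors0 \<rho> \<Longrightarrow> charge_conj s \<in> spinors1 \<rho>" "s \<in> spinors1 \<rho> \<Longrightarrow> charge_conj s \<in> spinors0 \<rho>"
proof -
  have "charge_conj (\<gamma> UNIV *v s) = \<gamma> UNIV *v charge_conj s" for s
    using gamma_anticommute[of charge_conj UNIV s] charge_conj_gammav[of "axis _ 1"]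
    by (simp add: charge_conj_scaleR dim gammav_axis power_add power_mult)
  then have v: "volume_action \<rho> (charge_conj s) = - charge_conj (volume_action \<rho> s)" for s
    by (simp add: volume_action charge_conj_scaleR charge_conj_scale vec.scale_minus_left)
  show "s \<in> spinors0 \<rho> \<Longrightarrow> charge_conj s \<in> spinors1 \<rho>" "s \<in> spinors1 \<rho> \<Longrightarrow> charge_conj s \<in> spinors0 \<rho>"
    by (simp_all add: spinors0_def spinors1_def v charge_conj_minus)
qed

lemma spinors_scale:
  "s \<in> spinors0 \<rho> \<Longrightarrow> c *s s \<in> spinors0 \<rho>" "s \<in> spinors1 \<rho> \<Longrightarrow> c *s s \<in> spinors1 \<rho>"
  by (simp_all add: spinors0_def spinors1_def volume_action_scale vec.scale_minus_right)

text \<open>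
  The map \<open>T\<close> commutes with the real volume element and anticommutes with \<open>\<plusminus>\<i>\<close> times it, so it is
  antilinear; hence it is given by a matrix acting on the conjugate vector, which is an intertwiner
  and therefore a multiple of \<open>conj_matrix\<close>.
\<close>

lemma odd_anticommuting_endomorphism:
  assumes add: "\<And>s t. T (s + t) = T s + T t" and sc: "\<And>r s. T (r *\<^sub>R s) = r *\<^sub>R T s"
    and anti: "\<And>v s. T (\<gamma>v v *v s) = - (\<gamma>v v *v T s)"
    and odd: "T ` spinors0 \<rho> \<subseteq> spinors1 \<rho>" "T ` spinors1 \<rho> \<subseteq> spinors0 \<rho>"
  obtains c where "\<And>s. T s = c *s charge_conj s"
proof -
  have anti_i: "T (\<gamma> {i} *v s) = - (\<gamma> {i} *v T s)" for i s
    using anti[of "axis i 1"] by (simp add: gammav_axis)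
  have vol: "T (\<gamma> UNIV *v s) = \<gamma> UNIV *v T s" for s
    using gamma_anticommute[OF sc anti_i, where A = UNIV] by (simp add: dim power_add power_mult)
  have neg: "T (- s) = - T s" for s using sc[of "-1"] by simp
  have i: "T (\<i> *s t) = - (\<i> *s T t)" for t
  proof -
    define s where "s = - (\<gamma> UNIV *v t)"
    have s: "\<gamma> UNIV *v s = t" by (simp add: s_def vec.neg gamma_UNIV_square)
    have "(-1) ^ n *\<^sub>R T (\<i> *s t) = - ((-1) ^ n *\<^sub>R (\<i> *s T t))"
      using odd_anticommutes_volume[OF add sc odd, of s]
      by (simp add: volume_action sc s flip: vol)
    then have "(-1) ^ n *\<^sub>R T (\<i> *s t) = (-1) ^ n *\<^sub>R (- (\<i> *s T t))" by simp
    then show ?thesis by (simp only: scaleR_cancel_left) simp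
  qed
  have cnj_scale: "T (c *s s) = cnj c *s T s" for c s
  proof -
    have "c *s s = Re c *\<^sub>R s + Im c *\<^sub>R (\<i> *s s)"
      by (subst complex_eq) (simp add: vector_scaleR_eq vec.scale_left_distrib vector_smult_assoc ac_simps)
    then have "T (c *s s) = Re c *\<^sub>R T s + Im c *\<^sub>R (- (\<i> *s T s))" by (simp add: add sc i)
    also have "\<dots> = cnj c *s T s"
      by (subst (3) complex_eq)
         (simp add: vec_eq_iff complex_eq_iff algebra_simps)
    finally show ?thesis .
  qed
  have "Vector_Spaces.linear (*s) (*s) (\<lambda>s. T (vec_cnj s))"
    by unfold_locales (simp_all add: add cnj_scale)
  from matrix_works[OF this] have "T (vec_cnj s) = matrix (\<lambda>s. T (vec_cnj s)) *v s" for s by simp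
  then obtain B where B: "\<And>s. T (vec_cnj s) = B *v s" by blast
  have "\<gamma> {i} ** B = B ** transpose (\<gamma> {i})" for i
    unfolding matrix_eq
  proof
    fix s
    have "vec_cnj (\<gamma> {i} *v vec_cnj s) = - (transpose (\<gamma> {i}) *v s)"
      using vec_cnj_gammav[of "axis i 1" "vec_cnj s"] by (simp add: gammav_axis)
    from arg_cong[OF this, of vec_cnj]
    have "T (\<gamma> {i} *v vec_cnj s) = - (B *v (transpose (\<gamma> {i}) *v s))"
      by (simp only: vec_cnj_simps neg B)
    then show "(\<gamma> {i} ** B) *v s = (B ** transpose (\<gamma> {i})) *v s"
      by (simp add: anti_i B matrix_vector_mul_assoc del: transpose_matrix_vector)
  qed
  then have "intertwiner B" by (simp add: intertwiner_def)
  then obtain z where "\<And>s. B *v s = z *s (conj_matrix *v s)"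
    using intertwiner_unique[OF conj_matrix(1,2)] by blast
  then have "T s = z *s charge_conj s" for s
    using B[of "vec_cnj s"] by (simp add: charge_conj_def)
  then show ?thesis by (rule that)
qed

end

section \<open>The spin group\<close>

abbreviation vec_prod :: "(real ^ 'm::{finite,linorder}) list \<Rightarrow> 'm cl" where
  "vec_prod vs \<equiv> foldr cl_mult (map cl_vec vs) cl_one"

abbreviation unit_vectors :: "'a::real_normed_vector list \<Rightarrow> bool" where
  "unit_vectors vs \<equiv> (\<forall>v\<in>set vs. norm v = 1)"

lemma spin_groupI: "even (length vs) \<Longrightarrow> unit_vectors vs \<Longrightarrow> vec_prod vs \<in> carrier spin_group"
  unfolding spin_group_def by auto

lemma spin_groupE:
  assumes "\<mu> \<in> carrier spin_group"
  obtains vs where "\<mu> = vec_prod vs" "even (length vs)" "unit_vectors vs"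
  using assms unfolding spin_group_def by auto

lemma spin_group_simps [simp]:
  "\<mu> \<otimes>\<^bsub>spin_group\<^esub> \<nu> = cl_mult \<mu> \<nu>" "\<one>\<^bsub>spin_group\<^esub> = cl_one"
  by (simp_all add: spin_group_def)

lemma vec_prod_append: "vec_prod (vs @ ws) = cl_mult (vec_prod vs) (vec_prod ws)"
  by (induction vs) (simp_all add: cl_mult_assoc)

lemma vec_prod_inverse:
  "unit_vectors vs \<Longrightarrow> cl_mult (vec_prod vs) (vec_prod (rev (map uminus vs))) = cl_one"
proof (induction vs)
  case Nil
  then show ?case by simp
next
  case (Cons v vs)
  have neg: "cl_vec (- v) = (-1) *\<^sub>R cl_vec v" by (simp add: linear_neg[OF linear_cl_vec])
  have "v \<bullet> v = 1" using Cons.prems by (simp add: norm_eq_1)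
  then have v: "cl_mult (cl_vec v) (cl_vec (- v)) = cl_one"
    unfolding neg cl_mult_scaleR cl_vec_square by simp
  have "cl_mult (vec_prod (v # vs)) (vec_prod (rev (map uminus (v # vs)))) =
      cl_mult (cl_vec v) (cl_mult (cl_mult (vec_prod vs) (vec_prod (rev (map uminus vs)))) (cl_vec (- v)))"
    by (simp add: vec_prod_append cl_mult_assoc del: map_append foldr_append)
  with Cons v show ?case by simp
qed

text \<open>
  The inverse of \<open>v\<^sub>1 \<dots> v\<^sub>k\<close> is \<open>(-v\<^sub>k) \<dots> (-v\<^sub>1)\<close>, since \<open>v (-v) = |v|\<^sup>2\<close>.
\<close>

lemma group_spin_group: "group (spin_group :: 'm::{finite,linorder} cl monoid)"
proof (rule groupI; simp)
  fix \<mu> \<nu> :: "'m cl" assume "\<mu> \<in> carrier spin_group" "\<nu> \<in> carrier spin_group"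
  then obtain vs ws where "\<mu> = vec_prod vs" "even (length vs)" "unit_vectors vs"
      "\<nu> = vec_prod ws" "even (length ws)" "unit_vectors ws"
    by (metis spin_groupE)
  then show "cl_mult \<mu> \<nu> \<in> carrier spin_group"
    using spin_groupI[of "vs @ ws"] by (auto simp: vec_prod_append simp del: map_append foldr_append)
next
  show "cl_one \<in> carrier (spin_group :: 'm cl monoid)" using spin_groupI[of "[]"] by simp
next
  fix \<mu> :: "'m cl" assume "\<mu> \<in> carrier spin_group"
  then obtain vs where vs: "\<mu> = vec_prod vs" "even (length vs)" "unit_vectors vs" by (rule spin_groupE)
  let ?ws = "rev (map uminus vs)"
  have "unit_vectors ?ws" using vs(3) by auto
  from vec_prod_inverse[OF this] have "cl_mult (vec_prod ?ws) \<mu> = cl_one"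
    by (simp add: vs(1) rev_map o_def)
  moreover have "vec_prod ?ws \<in> carrier spin_group"
    by (rule spin_groupI) (use vs in auto)
  ultimately show "\<exists>\<nu>\<in>carrier spin_group. cl_mult \<nu> \<mu> = cl_one" by blast
qed (simp add: cl_mult_assoc)

lemma minus_one_in_spin_group: "- cl_one \<in> carrier (spin_group :: 'm::{finite,linorder} cl monoid)"
proof -
  let ?v = "axis undefined 1 :: real ^ 'm::{finite,linorder}"
  have "vec_prod [?v, ?v] = - cl_one" by (simp add: cl_vec_square inner_axis_axis)
  then show ?thesis using spin_groupI[of "[?v, ?v]"] by simp
qed

lemma cl_mult_minus [simp]: "cl_mult (- x) y = - cl_mult x y" "cl_mult x (- y) = - cl_mult x y"
  using cl_mult_scaleR(1)[of "-1" x y] cl_mult_scaleR(2)[of x "-1" y] by simp_all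

lemma minus_in_spin_group: "\<mu> \<in> carrier spin_group \<Longrightarrow> - \<mu> \<in> carrier spin_group"
  using monoid.m_closed[OF group.is_monoid[OF group_spin_group] minus_one_in_spin_group, of \<mu>]
  by simp

text \<open>Conjugation by a unit vector \<open>v\<close> is, up to sign, the reflection in its orthogonal complement,
  so conjugation by a product of unit vectors preserves the space of vectors.\<close>

lemma vec_prod_conjugation:
  "unit_vectors vs \<Longrightarrow> \<exists>\<eta>. cl_mult (vec_prod vs) (cl_vec \<xi>) = cl_mult (cl_vec \<eta>) (vec_prod vs)"
proof (induction vs)
  case Nil
  then show ?case by auto
next
  case (Cons v vs)
  then obtain \<zeta> where \<zeta>: "cl_mult (vec_prod vs) (cl_vec \<xi>) = cl_mult (cl_vec \<zeta>) (vec_prod vs)" by auto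
  let ?\<eta> = "(2 * (v \<bullet> \<zeta>)) *\<^sub>R v - \<zeta>"
  have "v \<bullet> v = 1" using Cons.prems by (simp add: norm_eq_1)
  then have "cl_mult (cl_vec ?\<eta>) (cl_vec v) = (- (2 * (v \<bullet> \<zeta>))) *\<^sub>R cl_one - cl_mult (cl_vec \<zeta>) (cl_vec v)"
    by (simp add: linear_diff[OF linear_cl_vec] linear_scale[OF linear_cl_vec] cl_mult_scaleR
        cl_vec_square bilinear_lsub[OF bilinear_cl_mult])
  also have "\<dots> = cl_mult (cl_vec v) (cl_vec \<zeta>)"
    using cl_vec_polar[of v \<zeta>] by (simp add: algebra_simps)
  finally have "cl_mult (cl_vec v) (cl_vec \<zeta>) = cl_mult (cl_vec ?\<eta>) (cl_vec v)" by simp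
  then have "cl_mult (vec_prod (v # vs)) (cl_vec \<xi>) = cl_mult (cl_vec ?\<eta>) (vec_prod (v # vs))"
    by (simp add: cl_mult_assoc \<zeta>) (simp flip: cl_mult_assoc)
  then show ?case by blast
qed

text \<open>
  Here it matters that \<open>spin_ad\<close>, which only reads off the coefficients at the \<open>e\<^sub>i\<close>, loses nothing: by
  \<open>vec_prod_conjugation\<close> the conjugated vector is a vector again.
\<close>

lemma cl_vec_spin_ad:
  assumes "\<mu> \<in> carrier spin_group"
  shows "cl_mult (cl_vec (spin_ad \<mu> \<xi>)) \<mu> = cl_mult \<mu> (cl_vec \<xi>)"
proof -
  let ?i = "inv\<^bsub>spin_group\<^esub> \<mu>"
  obtain \<eta> where \<eta>: "cl_mult \<mu> (cl_vec \<xi>) = cl_mult (cl_vec \<eta>) \<mu>"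
    using assms vec_prod_conjugation by (metis spin_groupE)
  have "cl_mult \<mu> ?i = cl_one" using group.r_inv[OF group_spin_group assms] by simp
  then have "cl_mult (cl_mult \<mu> (cl_vec \<xi>)) ?i = cl_vec \<eta>" by (simp add: \<eta> cl_mult_assoc)
  then have "spin_ad \<mu> \<xi> = \<eta>" by (simp add: spin_ad_def cl_vec_nth vec_eq_iff)
  then show ?thesis by (simp add: \<eta>)
qed

section \<open>The group \<open>Spin\<^sup>c\<close>\<close>

abbreviation spin_U1 :: "('m::{finite,linorder} cl \<times> complex) monoid" where
  "spin_U1 \<equiv> spin_group \<times>\<times> U1_group"

abbreviation spin_U1_kernel :: "('m::{finite,linorder} cl \<times> complex) set" where
  "spin_U1_kernel \<equiv> {(cl_one, 1), (- cl_one, - 1)}"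

lemma U1_group_simps [simp]:
  "u \<otimes>\<^bsub>U1_group\<^esub> w = u * w" "\<one>\<^bsub>U1_group\<^esub> = 1" "u \<in> carrier U1_group \<longleftrightarrow> norm u = 1"
  by (simp_all add: U1_group_def)

lemma group_U1_group: "group U1_group"
proof (rule groupI)
  fix u assume "u \<in> carrier U1_group"
  then have "inverse u \<in> carrier U1_group" "inverse u * u = 1"
    by (auto simp: norm_inverse intro!: left_inverse)
  then show "\<exists>w\<in>carrier U1_group. w \<otimes>\<^bsub>U1_group\<^esub> u = \<one>\<^bsub>U1_group\<^esub>"
    by auto
qed (auto simp: norm_mult)

lemma group_spin_U1: "group spin_U1"
  using DirProd_group[OF group_spin_group group_U1_group] .

lemma spin_U1_simps [simp]:
  "(\<mu>, u) \<otimes>\<^bsub>spin_U1\<^esub> (\<nu>, w) = (cl_mult \<mu> \<nu>, u * w)"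
  "\<one>\<^bsub>spin_U1\<^esub> = (cl_one, 1)"
  "(\<mu>, u) \<in> carrier spin_U1 \<longleftrightarrow> \<mu> \<in> carrier spin_group \<and> norm u = 1"
  by (simp_all add: one_DirProd)

lemma spin_U1_coset: "spin_U1_kernel #>\<^bsub>spin_U1\<^esub> (\<mu>, u) = {(\<mu>, u), (- \<mu>, - u)}"
  by (auto simp: r_coset_def)

lemma normal_spin_U1_kernel: "spin_U1_kernel \<lhd> (spin_U1 :: ('m::{finite,linorder} cl \<times> complex) monoid)"
proof (rule group.normalI[OF group_spin_U1])
  have one: "cl_one \<in> carrier (spin_group :: 'm cl monoid)"
    using group.is_monoid[OF group_spin_group, THEN monoid.one_closed] by simp
  show "subgroup spin_U1_kernel (spin_U1 :: ('m cl \<times> complex) monoid)"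
  proof (rule group.subgroupI[OF group_spin_U1])
    fix a assume a: "a \<in> (spin_U1_kernel :: ('m cl \<times> complex) set)"
    have "inv\<^bsub>spin_U1\<^esub> a = a"
      by (rule group.inv_equality[OF group_spin_U1])
         (use a one minus_one_in_spin_group in auto)
    with a show "inv\<^bsub>spin_U1\<^esub> a \<in> spin_U1_kernel" by simp
  qed (use one minus_one_in_spin_group in auto)
  show "\<forall>a\<in>carrier spin_U1. spin_U1_kernel #>\<^bsub>spin_U1\<^esub> a = a <#\<^bsub>spin_U1\<^esub> spin_U1_kernel"
    by (auto simp: r_coset_def l_coset_def)
qed

lemma group_spinc_group: "group spinc_group"
  unfolding spinc_group_def by (rule normal.factorgroup_is_group[OF normal_spin_U1_kernel])

text \<open>
  Elements of \<open>Spin\<^sup>c\<close> are cosets of a two-element group, that is, pairs of opposite representatives.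
\<close>

lemma spinc_group_cases:
  assumes "g \<in> carrier spinc_group" "a \<in> g"
  obtains \<mu> u where "a = (\<mu>, u)" "\<mu> \<in> carrier spin_group" "norm u = 1" "g = {(\<mu>, u), (- \<mu>, - u)}"
proof -
  obtain \<nu> w where "(\<nu>, w) \<in> carrier spin_U1" "g = {(\<nu>, w), (- \<nu>, - w)}"
    using assms(1) spin_U1_coset unfolding spinc_group_def FactGroup_def RCOSETS_def by fastforce
  then show ?thesis
    using assms(2) that[of \<nu> w] that[of "- \<nu>" "- w"] minus_in_spin_group[of \<nu>] by auto
qed

lemma spinc_group_nonempty: "g \<in> carrier spinc_group \<Longrightarrow> \<exists>\<mu> u. (\<mu>, u) \<in> g"
  using spin_U1_coset unfolding spinc_group_def FactGroup_def RCOSETS_def by fastforce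

lemma spinc_group_one: "(cl_one, 1) \<in> \<one>\<^bsub>spinc_group\<^esub>"
  by (simp add: spinc_group_def)

lemma spinc_group_mult:
  "(\<mu>, u) \<in> g \<Longrightarrow> (\<nu>, w) \<in> h \<Longrightarrow> (cl_mult \<mu> \<nu>, u * w) \<in> g \<otimes>\<^bsub>spinc_group\<^esub> h"
  unfolding spinc_group_def FactGroup_def set_mult_def by force

context spinor_module
begin

lemma charge_conj_spin:
  assumes "\<mu> \<in> carrier spin_group"
  shows "charge_conj (\<rho> \<mu> *v s) = \<rho> \<mu> *v charge_conj s"
proof -
  have "charge_conj (\<rho> (vec_prod vs) *v s) = (-1) ^ length vs *\<^sub>R (\<rho> (vec_prod vs) *v charge_conj s)" for vs
  proof (induction vs arbitrary: s)
    case (Cons v vs)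
    then show ?case
      by (simp add: rho_mult charge_conj_gammav matrix_vector_scaleR flip: matrix_vector_mul_assoc)
  qed simp
  with assms show ?thesis by (auto elim!: spin_groupE)
qed

lemma inner_spin:
  assumes "\<mu> \<in> carrier spin_group"
  shows "(\<rho> \<mu> *v s) \<bullet> (\<rho> \<mu> *v t) = s \<bullet> t"
proof -
  have "unit_vectors vs \<Longrightarrow> (\<rho> (vec_prod vs) *v s) \<bullet> (\<rho> (vec_prod vs) *v t) = s \<bullet> t" for vs
    by (induction vs) (simp_all add: rho_mult inner_gammav norm_eq_1 flip: matrix_vector_mul_assoc)
  with assms show ?thesis by (auto elim!: spin_groupE)
qed

lemma volume_action_spin:
  assumes "\<mu> \<in> carrier spin_group"
  shows "volume_action \<rho> (\<rho> \<mu> *v s) = \<rho> \<mu> *v volume_action \<rho> s"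
proof -
  have "volume_action \<rho> (\<gamma>v v *v s) = - (\<gamma>v v *v volume_action \<rho> s)" for v s
  proof -
    have "odd (card (UNIV - {i}))" for i :: 'm by (simp add: card_Diff_singleton dim)
    then have "\<gamma> {i} ** \<gamma> UNIV = (-1) *\<^sub>R (\<gamma> UNIV ** \<gamma> {i})" for i by (simp add: gamma_swap)
    then have "\<gamma>v v ** \<gamma> UNIV = (-1) *\<^sub>R (\<gamma> UNIV ** \<gamma>v v)"
      by (simp add: gammav_sum matrix_mult_sum_left matrix_mult_sum_right matrix_mult_scaleR sum_negf)
    then have "\<gamma>v v *v (\<gamma> UNIV *v s) = - (\<gamma> UNIV *v (\<gamma>v v *v s))"
      by (simp only: matrix_vector_mul_assoc matrix_vector_scaleR) simp
    then show ?thesis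
      by (simp add: volume_action matrix_vector_scaleR vector_scalar_commute vec.scale_minus_right)
  qed
  then have "volume_action \<rho> (\<rho> (vec_prod vs) *v s) = (-1) ^ length vs *\<^sub>R (\<rho> (vec_prod vs) *v volume_action \<rho> s)" for vs s
    by (induction vs arbitrary: s)
       (simp_all add: rho_mult matrix_vector_scaleR flip: matrix_vector_mul_assoc)
  with assms show ?thesis by (auto elim!: spin_groupE)
qed

end

section \<open>Fibres of associated bundles\<close>

locale spinc_bundle =
  fixes X :: "('x::{t2_space,second_countable_topology}, 'm::{finite,linorder}, 'p) spinc_manifold"
  assumes spinc: "is_spinc_manifold X"
begin

sublocale smooth_atlas X
  by unfold_locales (use spinc in \<open>simp add: is_spinc_manifold_def oriented_riemannian_manifold_def\<close>)

lemma principal: "principal_spinc_bundle X" and frame_map: "spinc_frame_map X"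
  using spinc by (simp_all add: is_spinc_manifold_def)

lemma ract_one [simp]: "ract X p \<one>\<^bsub>spinc_group\<^esub> = p"
  using principal by (simp add: principal_spinc_bundle_def)

lemma ract_mult:
  "g \<in> carrier spinc_group \<Longrightarrow> h \<in> carrier spinc_group \<Longrightarrow>
     ract X (ract X p g) h = ract X p (g \<otimes>\<^bsub>spinc_group\<^esub> h)"
  using principal by (simp add: principal_spinc_bundle_def)

lemma bproj_ract [simp]: "g \<in> carrier spinc_group \<Longrightarrow> bproj X (ract X p g) = bproj X p"
  using principal by (simp add: principal_spinc_bundle_def)

lemma ract_ex1:
  "\<forall>p q. bproj X p = bproj X q \<longrightarrow> (\<exists>!g. g \<in> carrier spinc_group \<and> q = ract X p g)"
  using principal unfolding principal_spinc_bundle_def by (elim conjE)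

lemma ract_transitive:
  assumes "bproj X p = bproj X q"
  shows "\<exists>g\<in>carrier spinc_group. q = ract X p g"
  using ract_ex1[rule_format, OF assms] by blast

lemma ract_free:
  assumes "g \<in> carrier spinc_group" "h \<in> carrier spinc_group" "ract X p g = ract X p h"
  shows "g = h"
proof -
  have "bproj X p = bproj X (ract X p g)" using assms(1) by simp
  from ract_ex1[rule_format, OF this] show ?thesis using assms by blast
qed

lemma spinc_one_closed: "\<one>\<^bsub>spinc_group\<^esub> \<in> carrier spinc_group"
  by (rule monoid.one_closed[OF group.is_monoid[OF group_spinc_group]])

lemma spinc_mult_closed:
  "g \<in> carrier spinc_group \<Longrightarrow> h \<in> carrier spinc_group \<Longrightarrow> g \<otimes>\<^bsub>spinc_group\<^esub> h \<in> carrier spinc_group"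
  by (rule monoid.m_closed[OF group.is_monoid[OF group_spinc_group]])

lemma local_section_at: obtains V \<sigma> where "(V, \<sigma>) \<in> local_sections X" "x \<in> V"
proof -
  have "(\<Union>(V, \<sigma>)\<in>local_sections X. V) = UNIV"
    using principal unfolding principal_spinc_bundle_def by (elim conjE)
  then have "x \<in> (\<Union>(V, \<sigma>)\<in>local_sections X. V)" by simp
  then show ?thesis using that by blast
qed

lemma local_section:
  assumes "(V, \<sigma>) \<in> local_sections X"
  shows "open V" "x \<in> V \<Longrightarrow> bproj X (\<sigma> x) = x"
proof -
  have "\<forall>(V, \<sigma>)\<in>local_sections X. open V \<and> (\<forall>x\<in>V. bproj X (\<sigma> x) = x)"
    using principal unfolding principal_spinc_bundle_def by (elim conjE)
  from bspec[OF this assms] show "open V" "x \<in> V \<Longrightarrow> bproj X (\<sigma> x) = x" by simp_all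
qed

lemma frame_point_exists: obtains p where "bproj X p = x"
  using local_section_at local_section(2) by metis

lemma local_section_transition:
  assumes "(V, \<sigma>) \<in> local_sections X" "(W, \<tau>) \<in> local_sections X" "x \<in> V \<inter> W"
  obtains N \<mu> u where "open N" "x \<in> N" "N \<subseteq> V \<inter> W" "smooth_fun X N \<mu>" "smooth_fun X N u"
    "\<And>y. y \<in> N \<Longrightarrow> \<exists>g\<in>carrier spinc_group. (\<mu> y, u y) \<in> g \<and> \<tau> y = ract X (\<sigma> y) g"
proof -
  have "\<forall>(V, \<sigma>)\<in>local_sections X. \<forall>(W, \<tau>)\<in>local_sections X. \<forall>x\<in>V \<inter> W.
        \<exists>N \<mu> u. open N \<and> x \<in> N \<and> N \<subseteq> V \<inter> W \<and> smooth_fun X N \<mu> \<and> smooth_fun X N u \<and>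
          (\<forall>y\<in>N. \<exists>g\<in>carrier spinc_group. (\<mu> y, u y) \<in> g \<and> \<tau> y = ract X (\<sigma> y) g)"
    using principal unfolding principal_spinc_bundle_def by (elim conjE)
  from bspec[OF this assms(1), simplified, THEN bspec, OF assms(2), simplified, THEN bspec, OF assms(3)]
  show ?thesis using that by blast
qed

lemma frame_bij: "bij_betw (frame X p) UNIV (tangent_space X (bproj X p))"
  using frame_map by (auto simp: spinc_frame_map_def intro: bij_oriented_orthonormal_frame)

lemma frame_ract:
  "g \<in> carrier spinc_group \<Longrightarrow> (\<mu>, u) \<in> g \<Longrightarrow> frame X (ract X p g) \<xi> = frame X p (spin_ad \<mu> \<xi>)"
proof -
  assume g: "g \<in> carrier spinc_group" "(\<mu>, u) \<in> g"
  have "\<forall>p. \<forall>g\<in>carrier spinc_group. \<forall>(\<mu>, u)\<in>g. frame X (ract X p g) = frame X p \<circ> spin_ad \<mu>"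
    using frame_map unfolding spinc_frame_map_def by (elim conjE)
  from bspec[OF bspec[OF spec[OF this] g(1)] g(2)] show ?thesis by simp
qed

end

text \<open>
  The point \<open>p\<close> of the principal bundle identifies the fibre under it with the representation space.
  Elements of the fibre are thereby the same as equivariant functions of \<open>p\<close>; the lemmas
  \<open>fibre_coord_ract\<close>, \<open>fibreI\<close> and \<open>fibre_ext\<close> below make this precise.
\<close>

definition fibre_coord :: "('p \<times> 'v) set \<Rightarrow> 'p \<Rightarrow> 'v" where
  "fibre_coord e p = (THE w. (p, w) \<in> e)"

text \<open>
  The assumptions say that \<open>r\<close>, given on pairs \<open>(\<mu>, u)\<close>, descends to an action of \<open>Spin\<^sup>c\<close>.
\<close>

locale spinc_rep = spinc_bundle X
  for X :: "('x::{t2_space,second_countable_topology}, 'm::{finite,linorder}, 'p) spinc_manifold" +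
  fixes r :: "'m cl \<times> complex \<Rightarrow> 'v::real_normed_vector \<Rightarrow> 'v"
  assumes r_one: "r (cl_one, 1) w = w"
    and r_mult: "r (cl_mult \<mu> \<nu>, u * v) w = r (\<mu>, u) (r (\<nu>, v) w)"
    and r_minus: "r (- \<mu>, - u) w = r (\<mu>, u) w"
begin

lemma r_eq: "g \<in> carrier spinc_group \<Longrightarrow> a \<in> g \<Longrightarrow> b \<in> g \<Longrightarrow> r a w = r b w"
  by (erule spinc_group_cases[of g a]) (auto simp: r_minus)

definition elem :: "'p \<Rightarrow> 'v \<Rightarrow> ('p \<times> 'v) set" where
  "elem q w = assoc_rel X r `` {(q, w)}"

lemma mem_elem:
  "(p, w') \<in> elem q w \<longleftrightarrow> (\<exists>g a. g \<in> carrier spinc_group \<and> a \<in> g \<and> q = ract X p g \<and> w' = r a w)"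
  by (auto simp: elem_def assoc_rel_def)

lemma assoc_fibre_iff: "e \<in> assoc_fibre X r x \<longleftrightarrow> (\<exists>q w. bproj X q = x \<and> e = elem q w)"
  by (auto simp: assoc_fibre_def quotient_def elem_def)

lemma elem_in_fibre: "bproj X q = x \<Longrightarrow> elem q w \<in> assoc_fibre X r x"
  by (auto simp: assoc_fibre_iff)

lemma elem_refl: "(q, w) \<in> elem q w"
  using spinc_one_closed spinc_group_one r_one by (force simp: mem_elem)

lemma fibre_bproj: "e \<in> assoc_fibre X r x \<Longrightarrow> (p, w) \<in> e \<Longrightarrow> bproj X p = x"
  by (auto simp: assoc_fibre_iff mem_elem)

text \<open>
  The structure group acts simply transitively on the fibre of the principal bundle.
\<close>

lemma fibre_ex1:
  assumes "e \<in> assoc_fibre X r x" "bproj X p = x"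
  shows "\<exists>!w. (p, w) \<in> e"
proof -
  from assms(1) obtain q w where q: "bproj X q = x" "e = elem q w" by (auto simp: assoc_fibre_iff)
  then obtain g where g: "g \<in> carrier spinc_group" "q = ract X p g"
    using ract_transitive assms(2) by metis
  obtain \<mu> u where a: "(\<mu>, u) \<in> g" using spinc_group_nonempty[OF g(1)] by blast
  show ?thesis
  proof (rule ex1I[of _ "r (\<mu>, u) w"])
    show "(p, r (\<mu>, u) w) \<in> e" using g a q(2) by (auto simp: mem_elem)
  next
    fix w' assume "(p, w') \<in> e"
    then obtain h b where "h \<in> carrier spinc_group" "b \<in> h" "q = ract X p h" "w' = r b w"
      using q(2) by (auto simp: mem_elem)
    then show "w' = r (\<mu>, u) w" using ract_free g a r_eq by metis
  qed
qed

lemma fibre_coord_mem: "e \<in> assoc_fibre X r x \<Longrightarrow> bproj X p = x \<Longrightarrow> (p, fibre_coord e p) \<in> e"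
  unfolding fibre_coord_def by (rule theI') (rule fibre_ex1)

lemma fibre_coord_eq: "e \<in> assoc_fibre X r x \<Longrightarrow> (p, w) \<in> e \<Longrightarrow> fibre_coord e p = w"
  unfolding fibre_coord_def using fibre_ex1[OF _ fibre_bproj] by (intro the1_equality) blast+

lemma fibre_coord_elem [simp]: "fibre_coord (elem q w) q = w"
  using fibre_coord_eq elem_in_fibre elem_refl by metis

lemma fibre_coord_ract:
  assumes e: "e \<in> assoc_fibre X r x" and p: "bproj X p = x" and g: "g \<in> carrier spinc_group" "a \<in> g"
  shows "fibre_coord e p = r a (fibre_coord e (ract X p g))"
proof (rule fibre_coord_eq[OF e])
  obtain q w where q: "bproj X q = x" "e = elem q w" using e by (auto simp: assoc_fibre_iff)
  have "(ract X p g, fibre_coord e (ract X p g)) \<in> e"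
    using fibre_coord_mem[OF e] p g by simp
  then obtain h b where h: "h \<in> carrier spinc_group" "b \<in> h" "q = ract X (ract X p g) h"
      "fibre_coord e (ract X p g) = r b w"
    unfolding q(2) mem_elem by blast
  obtain \<mu> u \<nu> v where ab: "a = (\<mu>, u)" "b = (\<nu>, v)" by (cases a; cases b)
  have "(cl_mult \<mu> \<nu>, u * v) \<in> g \<otimes>\<^bsub>spinc_group\<^esub> h" using spinc_group_mult g(2) h(2) ab by blast
  moreover have "q = ract X p (g \<otimes>\<^bsub>spinc_group\<^esub> h)" using h g ract_mult by simp
  ultimately show "(p, r a (fibre_coord e (ract X p g))) \<in> e"
    using spinc_mult_closed g h unfolding q(2) mem_elem h(4) ab by (metis r_mult)
qed

lemma fibreI:
  assumes "\<And>p g \<mu> u. bproj X p = x \<Longrightarrow> g \<in> carrier spinc_group \<Longrightarrow> (\<mu>, u) \<in> g \<Longrightarrow>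
             f p = r (\<mu>, u) (f (ract X p g))"
  shows "{(p, f p) |p. bproj X p = x} \<in> assoc_fibre X r x"
proof -
  obtain q where q: "bproj X q = x" by (rule frame_point_exists)
  have "{(p, f p) |p. bproj X p = x} = elem q (f q)"
  proof (rule Set.set_eqI, rule iffI)
    fix z assume "z \<in> {(p, f p) |p. bproj X p = x}"
    then obtain p where p: "z = (p, f p)" "bproj X p = x" by blast
    then obtain g where g: "g \<in> carrier spinc_group" "q = ract X p g"
      using ract_transitive q by metis
    moreover obtain \<mu> u where "(\<mu>, u) \<in> g" using spinc_group_nonempty[OF g(1)] by blast
    ultimately show "z \<in> elem q (f q)" using assms p unfolding p(1) mem_elem by blast
  next
    fix z assume z: "z \<in> elem q (f q)"
    obtain p w where pw: "z = (p, w)" by (cases z)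
    with z obtain g a where g: "g \<in> carrier spinc_group" "a \<in> g" "q = ract X p g" "w = r a (f q)"
      by (auto simp: mem_elem)
    moreover have "bproj X p = x" using g q by auto
    ultimately show "z \<in> {(p, f p) |p. bproj X p = x}"
      using assms[of p g "fst a" "snd a"] pw by auto
  qed
  then show ?thesis using elem_in_fibre q by simp
qed

lemma fibre_eq: "e \<in> assoc_fibre X r x \<Longrightarrow> e = {(p, fibre_coord e p) |p. bproj X p = x}"
  using fibre_coord_mem fibre_coord_eq fibre_bproj by fast

lemma fibre_mem_iff:
  "e \<in> assoc_fibre X r x \<Longrightarrow> (p, w) \<in> e \<longleftrightarrow> bproj X p = x \<and> w = fibre_coord e p"
  using fibre_coord_mem fibre_coord_eq fibre_bproj by blast

lemma fibre_ext:
  assumes "e \<in> assoc_fibre X r x" "e' \<in> assoc_fibre X r x" "bproj X p = x"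
    and "fibre_coord e p = fibre_coord e' p"
  shows "e = e'"
proof -
  have "fibre_coord e q = fibre_coord e' q" if q: "bproj X q = x" for q
  proof -
    obtain g where g: "g \<in> carrier spinc_group" "p = ract X q g"
      using ract_transitive q assms(3) by metis
    moreover obtain \<mu> u where "(\<mu>, u) \<in> g" using spinc_group_nonempty[OF g(1)] by blast
    ultimately show ?thesis using fibre_coord_ract[OF _ q] assms by metis
  qed
  then have "{(p, fibre_coord e p) |p. bproj X p = x} = {(p, fibre_coord e' p) |p. bproj X p = x}" by auto
  then show ?thesis using fibre_eq[OF assms(1)] fibre_eq[OF assms(2)] by metis
qed

lemma fibre_coord_graph:
  "bproj X p = x \<Longrightarrow> fibre_coord {(p, f p) |p. bproj X p = x} p = f p"
  by (simp add: fibre_coord_def)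

text \<open>
  A section has only one coordinate function in each local trivialization, so its smoothness is that
  of these functions.
\<close>

lemma smooth_assoc_section_on_iff:
  assumes "open U" "\<And>x. x \<in> U \<Longrightarrow> h x \<in> assoc_fibre X r x"
  shows "smooth_assoc_section_on X U h \<longleftrightarrow>
    (\<forall>(V, \<sigma>)\<in>local_sections X. smooth_fun X (U \<inter> V) (\<lambda>x. fibre_coord (h x) (\<sigma> x)))"
proof (rule iffI, rule ballI, unfold split_paired_all split_conv)
  fix V \<sigma> assume S: "smooth_assoc_section_on X U h" and V: "(V, \<sigma>) \<in> local_sections X"
  from bspec[OF S[unfolded smooth_assoc_section_on_def] V] obtain f where f: "smooth_fun X (U \<inter> V) f" "\<And>x. x \<in> U \<inter> V \<Longrightarrow> (\<sigma> x, f x) \<in> h x"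
    by auto
  show "smooth_fun X (U \<inter> V) (\<lambda>x. fibre_coord (h x) (\<sigma> x))"
  proof (rule smooth_fun_localI)
    fix x assume "x \<in> U \<inter> V"
    then show "\<exists>N g. open N \<and> x \<in> N \<and> smooth_fun X N g \<and> (\<forall>y\<in>N. g y = fibre_coord (h y) (\<sigma> y))"
      using f fibre_coord_eq assms local_section(1)[OF V]
      by (intro exI[of _ "U \<inter> V"] exI[of _ f]) (metis IntD1 open_Int)
  qed
next
  assume "\<forall>(V, \<sigma>)\<in>local_sections X. smooth_fun X (U \<inter> V) (\<lambda>x. fibre_coord (h x) (\<sigma> x))"
  then show "smooth_assoc_section_on X U h"
    unfolding smooth_assoc_section_on_def using fibre_coord_mem assms(2) local_section(2) by fast
qed

end

section \<open>The spinor bundle\<close>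

locale spinc_spinors = spinc_bundle X + spinor_module \<rho> n
  for X :: "('x::{t2_space,second_countable_topology}, 'm::{finite,linorder}, 'p) spinc_manifold"
    and \<rho> :: "'m cl \<Rightarrow> complex ^ 's ^ 's" and n
begin

abbreviation "det_rep \<equiv> (\<lambda>(\<mu>, u) z. u\<^sup>2 * z)"
abbreviation "spinor_rep \<equiv> (\<lambda>(\<mu>, u) s. u *s (\<rho> \<mu> *v s))"

sublocale L: spinc_rep X det_rep
  by unfold_locales (simp_all add: power_mult_distrib)

lemma rho_minus: "\<rho> (- \<mu>) = - \<rho> \<mu>"
  by (rule linear_neg[OF linear_rho])

sublocale S: spinc_rep X spinor_rep
proof unfold_locales
  fix \<mu> u w
  show "spinor_rep (- \<mu>, - u) w = spinor_rep (\<mu>, u) w"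
    using matrix_vector_scaleR(1)[of "-1" "\<rho> \<mu>" w]
    by (simp add: rho_minus vec.scale_minus_left vec.scale_minus_right)
qed (simp_all add: rho_mult vector_scalar_commute vector_smult_assoc flip: matrix_vector_mul_assoc)

lemma det_line_eq: "det_line X x = assoc_fibre X det_rep x"
  by (simp add: det_line_def)

lemma spinor_bundle_eq: "spinor_bundle X \<rho> x = assoc_fibre X spinor_rep x"
  by (simp add: spinor_bundle_def)

lemma spinor_add:
  assumes "e \<in> spinor_bundle X \<rho> x" "e' \<in> spinor_bundle X \<rho> x"
  shows "spinor_add e e' \<in> spinor_bundle X \<rho> x"
    and "bproj X p = x \<Longrightarrow> fibre_coord (spinor_add e e') p = fibre_coord e p + fibre_coord e' p"
proof -
  have eq: "spinor_add e e' = {(p, fibre_coord e p + fibre_coord e' p) |p. bproj X p = x}"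
    using assms by (auto simp: spinor_add_def spinor_bundle_eq S.fibre_mem_iff)
  show "spinor_add e e' \<in> spinor_bundle X \<rho> x"
    unfolding eq spinor_bundle_eq
  proof (rule S.fibreI)
    fix p and g :: "'m::{finite,linorder} spinc" and \<mu> u assume p: "bproj X p = x" and g: "g \<in> carrier spinc_group" "(\<mu>, u) \<in> g"
    show "fibre_coord e p + fibre_coord e' p =
        spinor_rep (\<mu>, u) (fibre_coord e (ract X p g) + fibre_coord e' (ract X p g))"
      using S.fibre_coord_ract[OF _ p g] assms
      by (simp add: spinor_bundle_eq matrix_vector_right_distrib vec.scale_right_distrib)
  qed
  show "fibre_coord (spinor_add e e') p = fibre_coord e p + fibre_coord e' p" if "bproj X p = x"
    unfolding eq using S.fibre_coord_graph[OF that] .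
qed

lemma spinor_scale:
  assumes "e \<in> spinor_bundle X \<rho> x"
  shows "spinor_scale c e \<in> spinor_bundle X \<rho> x"
    and "bproj X p = x \<Longrightarrow> fibre_coord (spinor_scale c e) p = c *\<^sub>R fibre_coord e p"
proof -
  have eq: "spinor_scale c e = {(p, c *\<^sub>R fibre_coord e p) |p. bproj X p = x}"
    using assms by (auto simp: spinor_scale_def spinor_bundle_eq S.fibre_mem_iff)
  show "spinor_scale c e \<in> spinor_bundle X \<rho> x"
    unfolding eq spinor_bundle_eq
  proof (rule S.fibreI)
    fix p and g :: "'m::{finite,linorder} spinc" and \<mu> u assume p: "bproj X p = x" and g: "g \<in> carrier spinc_group" "(\<mu>, u) \<in> g"
    show "c *\<^sub>R fibre_coord e p = spinor_rep (\<mu>, u) (c *\<^sub>R fibre_coord e (ract X p g))"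
      using S.fibre_coord_ract[OF _ p g] assms
      by (simp add: spinor_bundle_eq vector_scaleR_eq vector_scalar_commute vec.scale_left_commute)
  qed
  show "fibre_coord (spinor_scale c e) p = c *\<^sub>R fibre_coord e p" if "bproj X p = x"
    unfolding eq using S.fibre_coord_graph[OF that] .
qed

lemma inner_unit_scale: "norm u = 1 \<Longrightarrow> (u *s s) \<bullet> (u *s t) = s \<bullet> t" for s t :: "complex ^ 's"
proof -
  assume "norm u = 1"
  then have "Re u * Re u + Im u * Im u = 1" by (simp add: cmod_def power2_eq_square)
  moreover have "(u * a) \<bullet> (u * b) = (Re u * Re u + Im u * Im u) * (a \<bullet> b)" for a b
    by (simp add: inner_complex_def algebra_simps)
  ultimately show ?thesis by (simp add: inner_vec_def)
qed

text \<open>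
  The definition chooses a frame; the value is the same in all of them because \<open>Spin\<^sup>c\<close> acts
  isometrically.
\<close>

lemma spinor_inner:
  assumes e: "e \<in> spinor_bundle X \<rho> x" "e' \<in> spinor_bundle X \<rho> x" and p: "bproj X p = x"
  shows "spinor_inner e e' = fibre_coord e p \<bullet> fibre_coord e' p"
  unfolding spinor_inner_def
proof (rule the_equality)
  show "\<exists>q s t. (q, s) \<in> e \<and> (q, t) \<in> e' \<and> fibre_coord e p \<bullet> fibre_coord e' p = s \<bullet> t"
    using S.fibre_coord_mem e p unfolding spinor_bundle_eq by blast
next
  fix c assume "\<exists>q s t. (q, s) \<in> e \<and> (q, t) \<in> e' \<and> c = s \<bullet> t"
  then obtain q where q: "bproj X q = x" and c: "c = fibre_coord e q \<bullet> fibre_coord e' q"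
    using S.fibre_coord_eq S.fibre_bproj e unfolding spinor_bundle_eq by metis
  obtain g where g: "g \<in> carrier spinc_group" "p = ract X q g"
    using ract_transitive p q by metis
  obtain \<mu> u where a: "(\<mu>, u) \<in> g" using spinc_group_nonempty[OF g(1)] by blast
  then have "\<mu> \<in> carrier spin_group" "norm u = 1" using spinc_group_cases[OF g(1) a] by auto
  then show "c = fibre_coord e p \<bullet> fibre_coord e' p"
    using S.fibre_coord_ract[OF _ q g(1) a] e
    by (simp add: c g(2) spinor_bundle_eq inner_unit_scale inner_spin)
qed

text \<open>
  The coordinates of a tangent vector in the frames \<open>p\<close> and \<open>p \<cdot> [\<mu>, u]\<close> differ by \<open>spin_ad \<mu>\<close>, which
  is conjugation by \<open>\<mu>\<close>; so Clifford multiplication by them is equivariant.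
\<close>

lemma clifford:
  assumes e: "e \<in> spinor_bundle X \<rho> x" and v: "v \<in> tangent_space X x"
  shows "clifford X \<rho> v e \<in> spinor_bundle X \<rho> x"
    and "bproj X p = x \<Longrightarrow> frame X p \<xi> = v \<Longrightarrow>
           fibre_coord (clifford X \<rho> v e) p = \<gamma>v \<xi> *v fibre_coord e p"
proof -
  define f where "f p = \<gamma>v (inv_into UNIV (frame X p) v) *v fibre_coord e p" for p
  have inj: "inj (frame X p)" for p using frame_bij bij_betw_imp_inj_on by blast
  have frame_inv: "frame X p (inv_into UNIV (frame X p) v) = v" if "bproj X p = x" for p
    using frame_bij[of p] v that by (metis bij_betw_imp_surj_on f_inv_into_f)
  have eq: "clifford X \<rho> v e = {(p, f p) |p. bproj X p = x}"
  proof (rule Set.set_eqI, rule iffI)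
    fix z assume "z \<in> clifford X \<rho> v e"
    then obtain p \<xi> s where "z = (p, \<gamma>v \<xi> *v s)" "(p, s) \<in> e" "frame X p \<xi> = v"
      unfolding clifford_def by blast
    then show "z \<in> {(p, f p) |p. bproj X p = x}"
      using S.fibre_coord_eq[OF e[unfolded spinor_bundle_eq]] S.fibre_bproj[OF e[unfolded spinor_bundle_eq]]
      by (auto simp: f_def inv_f_f[OF inj])
  next
    fix z assume "z \<in> {(p, f p) |p. bproj X p = x}"
    then obtain p where "z = (p, f p)" "bproj X p = x" by blast
    then show "z \<in> clifford X \<rho> v e"
      using S.fibre_coord_mem[OF e[unfolded spinor_bundle_eq]] frame_inv
      unfolding clifford_def f_def by blast
  qed
  show "clifford X \<rho> v e \<in> spinor_bundle X \<rho> x"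
    unfolding eq spinor_bundle_eq
  proof (rule S.fibreI)
    fix p and g :: "'m::{finite,linorder} spinc" and \<mu> u assume p: "bproj X p = x" and g: "g \<in> carrier spinc_group" "(\<mu>, u) \<in> g"
    let ?q = "ract X p g"
    let ?\<xi> = "inv_into UNIV (frame X ?q) v"
    have \<mu>: "\<mu> \<in> carrier spin_group" using spinc_group_cases[OF g] by auto
    have "frame X p (spin_ad \<mu> ?\<xi>) = v"
      using frame_ract[OF g] frame_inv[of ?q] p g by simp
    then have "inv_into UNIV (frame X p) v = spin_ad \<mu> ?\<xi>" using inv_f_f[OF inj] by metis
    then have "f p = \<gamma>v (spin_ad \<mu> ?\<xi>) *v (u *s (\<rho> \<mu> *v fibre_coord e ?q))"
      using S.fibre_coord_ract[OF _ p g] e by (simp add: f_def spinor_bundle_eq)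
    also have "\<dots> = u *s (\<rho> (cl_mult (cl_vec (spin_ad \<mu> ?\<xi>)) \<mu>) *v fibre_coord e ?q)"
      by (simp add: vector_scalar_commute rho_mult matrix_vector_mul_assoc)
    also have "\<dots> = spinor_rep (\<mu>, u) (f ?q)"
      unfolding cl_vec_spin_ad[OF \<mu>] by (simp add: f_def rho_mult matrix_vector_mul_assoc)
    finally show "f p = spinor_rep (\<mu>, u) (f ?q)" .
  qed
  show "fibre_coord (clifford X \<rho> v e) p = \<gamma>v \<xi> *v fibre_coord e p"
    if "bproj X p = x" "frame X p \<xi> = v"
    unfolding eq S.fibre_coord_graph[OF that(1)] f_def
    using inv_f_f[OF inj, of p \<xi>] that(2) by simp
qed

text \<open>
  The group \<open>Spin\<^sup>c\<close> commutes with the complex volume element, so the degree of a spinor can be read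
  off in any frame.
\<close>

lemma spinor_bundle_graded:
  assumes "e \<in> spinor_bundle X \<rho> x" "bproj X p = x"
  shows "e \<in> spinor_bundle0 X \<rho> x \<longleftrightarrow> fibre_coord e p \<in> spinors0 \<rho>"
    and "e \<in> spinor_bundle1 X \<rho> x \<longleftrightarrow> fibre_coord e p \<in> spinors1 \<rho>"
proof -
  have e: "e \<in> assoc_fibre X spinor_rep x" using assms(1) by (simp add: spinor_bundle_eq)
  have transport: "fibre_coord e q \<in> K" if K: "fibre_coord e p \<in> K" "(q, s) \<in> e"
      "\<And>c s. s \<in> K \<Longrightarrow> c *s s \<in> K" "\<And>\<mu> s. \<mu> \<in> carrier spin_group \<Longrightarrow> s \<in> K \<Longrightarrow> \<rho> \<mu> *v s \<in> K" for K q s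
  proof -
    have q: "bproj X q = x" using S.fibre_bproj[OF e] K(2) .
    obtain g where g: "g \<in> carrier spinc_group" "p = ract X q g"
      using ract_transitive assms(2) q by metis
    obtain \<mu> u where a: "(\<mu>, u) \<in> g" using spinc_group_nonempty[OF g(1)] by blast
    then have "\<mu> \<in> carrier spin_group" using spinc_group_cases[OF g(1) a] by auto
    then show ?thesis using S.fibre_coord_ract[OF e q g(1) a] K(1,3,4) g(2) by simp
  qed
  have spin: "s \<in> spinors0 \<rho> \<Longrightarrow> \<rho> \<mu> *v s \<in> spinors0 \<rho>" "s \<in> spinors1 \<rho> \<Longrightarrow> \<rho> \<mu> *v s \<in> spinors1 \<rho>"
    if "\<mu> \<in> carrier spin_group" for \<mu> s
    by (simp_all add: spinors0_def spinors1_def volume_action_spin[OF that] vec.neg)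
  have mem: "(p, fibre_coord e p) \<in> e" using S.fibre_coord_mem[OF e assms(2)] .
  show "e \<in> spinor_bundle0 X \<rho> x \<longleftrightarrow> fibre_coord e p \<in> spinors0 \<rho>"
    (is "?L \<longleftrightarrow> ?R")
  proof
    show "?L \<Longrightarrow> ?R" using mem unfolding spinor_bundle0_def by blast
  next
    assume ?R
    then have "s \<in> spinors0 \<rho>" if "(q, s) \<in> e" for q s
      using transport[OF _ that spinors_scale(1) spin(1)] S.fibre_coord_eq[OF e that] by simp
    then show ?L using assms(1) unfolding spinor_bundle0_def by blast
  qed
  show "e \<in> spinor_bundle1 X \<rho> x \<longleftrightarrow> fibre_coord e p \<in> spinors1 \<rho>"
    (is "?L \<longleftrightarrow> ?R")
  proof
    show "?L \<Longrightarrow> ?R" using mem unfolding spinor_bundle1_def by blast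
  next
    assume ?R
    then have "s \<in> spinors1 \<rho>" if "(q, s) \<in> e" for q s
      using transport[OF _ that spinors_scale(2) spin(2)] S.fibre_coord_eq[OF e that] by simp
    then show ?L using assms(1) unfolding spinor_bundle1_def by blast
  qed
qed

end

context spinc_spinors
begin

section \<open>The correspondence in a fibre\<close>

text \<open>
  In the frame \<open>p\<close> this is \<open>c J\<close>, where \<open>c\<close> is the coordinate of \<open>l\<close>.
\<close>

definition line_endo :: "'x \<Rightarrow> ('p \<times> complex) set \<Rightarrow> ('p, 's) spinor \<Rightarrow> ('p, 's) spinor" where
  "line_endo x l = (\<lambda>e\<in>spinor_bundle X \<rho> x.
     {(p, fibre_coord l p *s charge_conj (fibre_coord e p)) |p. bproj X p = x})"

text \<open>
  The factor \<open>u\<^sup>2\<close> compensates that an antilinear map turns \<open>u\<close> into its conjugate: \<open>u\<^sup>2\<close> times the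
  conjugate of \<open>u\<close> is \<open>u\<close>. Thus multiples of \<open>charge_conj\<close> transform like elements of the
  determinant line.
\<close>

lemma charge_conj_spinor_rep:
  assumes "g \<in> carrier spinc_group" "(\<mu>, u) \<in> g"
  shows "(u\<^sup>2 * c) *s charge_conj (spinor_rep (\<mu>, u) s) = spinor_rep (\<mu>, u) (c *s charge_conj s)"
proof -
  have \<mu>: "\<mu> \<in> carrier spin_group" and "norm u = 1" using spinc_group_cases[OF assms] by auto
  then have "u * cnj u = 1" by (metis complex_norm_square of_real_1 power_one)
  then have "u\<^sup>2 * c * cnj u = u * c" by (simp add: power2_eq_square ac_simps)
  then show ?thesis
    by (simp add: charge_conj_scale charge_conj_spin[OF \<mu>] vector_smult_assoc vector_scalar_commute)
qed

lemma line_endo: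
  assumes l: "l \<in> det_line X x" and e: "e \<in> spinor_bundle X \<rho> x"
  shows "line_endo x l e \<in> spinor_bundle X \<rho> x"
    and "bproj X p = x \<Longrightarrow>
           fibre_coord (line_endo x l e) p = fibre_coord l p *s charge_conj (fibre_coord e p)"
proof -
  have eq: "line_endo x l e = {(p, fibre_coord l p *s charge_conj (fibre_coord e p)) |p. bproj X p = x}"
    using e by (simp add: line_endo_def)
  show "line_endo x l e \<in> spinor_bundle X \<rho> x"
    unfolding eq spinor_bundle_eq
  proof (rule S.fibreI)
    fix p and g :: "'m::{finite,linorder} spinc" and \<mu> u
    assume p: "bproj X p = x" and g: "g \<in> carrier spinc_group" "(\<mu>, u) \<in> g"
    show "fibre_coord l p *s charge_conj (fibre_coord e p) = spinor_rep (\<mu>, u)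
        (fibre_coord l (ract X p g) *s charge_conj (fibre_coord e (ract X p g)))"
      unfolding S.fibre_coord_ract[OF e[unfolded spinor_bundle_eq] p g]
        L.fibre_coord_ract[OF l[unfolded det_line_eq] p g]
      using charge_conj_spinor_rep[OF g] by simp
  qed
  show "fibre_coord (line_endo x l e) p = fibre_coord l p *s charge_conj (fibre_coord e p)"
    if "bproj X p = x"
    unfolding eq using S.fibre_coord_graph[OF that] .
qed

lemma spinor_ext:
  assumes "e \<in> spinor_bundle X \<rho> x" "e' \<in> spinor_bundle X \<rho> x" "bproj X p = x"
    and "fibre_coord e p = fibre_coord e' p"
  shows "e = e'"
  using S.fibre_ext assms by (simp add: spinor_bundle_eq)

lemma tangent_vector_frame:
  assumes "v \<in> tangent_space X (bproj X p)"
  obtains \<xi> where "frame X p \<xi> = v"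
  using frame_bij[of p] assms by (metis bij_betw_imp_surj_on imageE)

lemma vec_scaleR_commute: "c *s (a *\<^sub>R s) = a *\<^sub>R (c *s s)" for s :: "complex ^ 's"
  by (simp add: vector_scaleR_eq vec.scale_left_commute)

text \<open>
  Each condition is an identity between spinors, so it suffices to verify it in one frame, where it
  is a property of \<open>J\<close>. The parity of \<open>n\<close> decides the symmetry type.
\<close>

lemma line_endo_in_LH_bundle:
  assumes l: "l \<in> det_line X x"
  shows "line_endo x l \<in> LH_bundle X \<rho> x"
proof -
  obtain p where p: "bproj X p = x" by (rule frame_point_exists)
  let ?T = "line_endo x l" and ?S = "spinor_bundle X \<rho> x" and ?c = "fibre_coord l p"
  note T = line_endo(1)[OF l] line_endo(2)[OF l _ p]
  have "?T \<in> ?S \<rightarrow>\<^sub>E ?S" using T(1) by (auto simp: line_endo_def)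
  moreover have "?T (spinor_add e e') = spinor_add (?T e) (?T e')" if e: "e \<in> ?S" "e' \<in> ?S" for e e'
    by (rule spinor_ext[OF _ _ p])
       (simp_all add: T e spinor_add[OF _ _] spinor_add(2)[OF _ _ p] charge_conj_add vec.scale_right_distrib)
  moreover have "?T (spinor_scale c e) = spinor_scale c (?T e)" if e: "e \<in> ?S" for c e
    by (rule spinor_ext[OF _ _ p])
       (simp_all add: T e spinor_scale(1) spinor_scale(2)[OF _ p] charge_conj_scaleR
         vec_scaleR_commute)
  ultimately have End: "?T \<in> spinor_End X \<rho> x" by (simp add: spinor_End_def)
  have grade: "?T e \<in> spinor_bundle1 X \<rho> x" if "e \<in> spinor_bundle0 X \<rho> x" for e
  proof -
    have e: "e \<in> ?S" using that by (simp add: spinor_bundle0_def)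
    then show ?thesis
      using that spinor_bundle_graded[OF e p] spinor_bundle_graded[OF T(1)[OF e] p] T(2)[OF e]
        spinors_scale charge_conj_odd by simp
  qed
  have grade': "?T e \<in> spinor_bundle0 X \<rho> x" if "e \<in> spinor_bundle1 X \<rho> x" for e
  proof -
    have e: "e \<in> ?S" using that by (simp add: spinor_bundle1_def)
    then show ?thesis
      using that spinor_bundle_graded[OF e p] spinor_bundle_graded[OF T(1)[OF e] p] T(2)[OF e]
        spinors_scale charge_conj_odd by simp
  qed
  have cliff: "?T (clifford X \<rho> v e) = spinor_scale (- 1) (clifford X \<rho> v (?T e))"
    if v: "v \<in> tangent_space X x" and e: "e \<in> ?S" for v e
  proof -
    obtain \<xi> where \<xi>: "frame X p \<xi> = v" using tangent_vector_frame v p by blast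
    note C = clifford(1)[OF _ v] clifford(2)[OF _ v p \<xi>]
    show ?thesis
      by (rule spinor_ext[OF _ _ p])
         (simp_all add: T C e spinor_scale(1) spinor_scale(2)[OF _ p] charge_conj_gammav
           vec.scale_minus_right vector_scalar_commute)
  qed
  have adj: "spinor_inner (?T e) e' = (-1) ^ n * spinor_inner e (?T e')" if e: "e \<in> ?S" "e' \<in> ?S" for e e'
  proof -
    have scale_inner: "(c *s s) \<bullet> t = s \<bullet> (cnj c *s t)" for c and s t :: "complex ^ 's"
      by (simp add: inner_vec_def inner_complex_def algebra_simps)
    have "(?c *s charge_conj s) \<bullet> t = (-1) ^ n * (s \<bullet> (?c *s charge_conj t))" for s t
      by (simp add: scale_inner charge_conj_adjoint charge_conj_scale)
    then show ?thesis
      by (simp add: T e spinor_inner[OF _ _ p])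
  qed
  have "even n" if "CARD('m) mod 8 = 2" using that dim by presburger
  moreover have "odd n" if "CARD('m) mod 8 = 6" using that dim by presburger
  ultimately show ?thesis
    using End grade grade' cliff adj unfolding LH_bundle_def by auto
qed

text \<open>
  Read in the frame \<open>p\<close>, the conditions that define the fibre of \<open>\<L>\<^sub>\<H>\<close> become the hypotheses of
  \<open>odd_anticommuting_endomorphism\<close>.
\<close>

lemma LH_bundle_in_frame:
  assumes T: "T \<in> LH_bundle X \<rho> x" and p: "bproj X p = x"
  shows "\<exists>c. \<forall>e\<in>spinor_bundle X \<rho> x. fibre_coord (T e) p = c *s charge_conj (fibre_coord e p)"
proof -
  let ?S = "spinor_bundle X \<rho> x"
  let ?e = "S.elem p"
  define t where "t s = fibre_coord (T (?e s)) p" for s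
  have elem: "?e s \<in> ?S" for s
    using S.elem_in_fibre[OF p] by (simp add: spinor_bundle_eq)
  have T_S: "T e \<in> ?S" if "e \<in> ?S" for e
    using T that by (auto simp: LH_bundle_def spinor_End_def)
  have eqI: "e = ?e s" if "e \<in> ?S" "fibre_coord e p = s" for e s
    using spinor_ext[OF that(1) elem p] that(2) by simp
  have add: "t (s + s') = t s + t s'" for s s'
  proof -
    have "?e (s + s') = spinor_add (?e s) (?e s')"
      by (rule eqI[symmetric]) (simp_all add: spinor_add(1) spinor_add(2)[OF _ _ p] elem)
    moreover have "T (spinor_add (?e s) (?e s')) = spinor_add (T (?e s)) (T (?e s'))"
      using T elem by (simp add: LH_bundle_def spinor_End_def)
    ultimately show ?thesis by (simp add: t_def spinor_add(2)[OF _ _ p] T_S elem)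
  qed
  have scale: "t (c *\<^sub>R s) = c *\<^sub>R t s" for c s
  proof -
    have "?e (c *\<^sub>R s) = spinor_scale c (?e s)"
      by (rule eqI[symmetric]) (simp_all add: spinor_scale(1) spinor_scale(2)[OF _ p] elem)
    moreover have "T (spinor_scale c (?e s)) = spinor_scale c (T (?e s))"
      using T elem by (simp add: LH_bundle_def spinor_End_def)
    ultimately show ?thesis by (simp add: t_def spinor_scale(2)[OF _ p] T_S elem)
  qed
  have anti: "t (\<gamma>v \<xi> *v s) = - (\<gamma>v \<xi> *v t s)" for \<xi> s
  proof -
    let ?v = "frame X p \<xi>"
    have v: "?v \<in> tangent_space X x" using frame_bij[of p] p by (auto simp: bij_betw_def)
    note C = clifford(1)[OF _ v] clifford(2)[OF _ v p refl]
    have "?e (\<gamma>v \<xi> *v s) = clifford X \<rho> ?v (?e s)"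
      by (rule eqI[symmetric]) (simp_all add: C elem)
    moreover have "T (clifford X \<rho> ?v (?e s)) = spinor_scale (- 1) (clifford X \<rho> ?v (T (?e s)))"
      using T elem v by (simp add: LH_bundle_def)
    ultimately show ?thesis by (simp add: t_def spinor_scale(2)[OF _ p] C T_S elem)
  qed
  have "t ` spinors0 \<rho> \<subseteq> spinors1 \<rho>"
  proof (rule image_subsetI)
    fix s assume "s \<in> spinors0 \<rho>"
    then have "?e s \<in> spinor_bundle0 X \<rho> x" using spinor_bundle_graded(1)[OF elem p] by simp
    then have "T (?e s) \<in> spinor_bundle1 X \<rho> x" using T by (auto simp: LH_bundle_def)
    then show "t s \<in> spinors1 \<rho>" using spinor_bundle_graded(2)[OF T_S[OF elem] p] by (simp add: t_def)
  qed
  moreover have "t ` spinors1 \<rho> \<subseteq> spinors0 \<rho>"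
  proof (rule image_subsetI)
    fix s assume "s \<in> spinors1 \<rho>"
    then have "?e s \<in> spinor_bundle1 X \<rho> x" using spinor_bundle_graded(2)[OF elem p] by simp
    then have "T (?e s) \<in> spinor_bundle0 X \<rho> x" using T by (auto simp: LH_bundle_def)
    then show "t s \<in> spinors0 \<rho>" using spinor_bundle_graded(1)[OF T_S[OF elem] p] by (simp add: t_def)
  qed
  ultimately obtain c where c: "\<And>s. t s = c *s charge_conj s"
    using odd_anticommuting_endomorphism[of t] add scale anti by blast
  have "fibre_coord (T e) p = c *s charge_conj (fibre_coord e p)" if "e \<in> ?S" for e
    using c[of "fibre_coord e p"] eqI[OF that refl] by (simp add: t_def)
  then show ?thesis by blast
qed

text \<open>
  By \<open>LH_bundle_in_frame\<close> the endomorphism is \<open>c(p) J\<close> in every frame \<open>p\<close>. Evaluation at a nonzero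
  spinor in two frames over the same point shows that \<open>c\<close> transforms with \<open>u\<^sup>2\<close>.
\<close>

lemma LH_bundle_line_endo:
  assumes T: "T \<in> LH_bundle X \<rho> x"
  shows "\<exists>l\<in>det_line X x. T = line_endo x l"
proof -
  let ?S = "spinor_bundle X \<rho> x"
  have T_S: "T e \<in> ?S" if "e \<in> ?S" for e
    using T that by (auto simp: LH_bundle_def spinor_End_def)
  obtain c where c: "\<And>p e. bproj X p = x \<Longrightarrow> e \<in> ?S \<Longrightarrow>
      fibre_coord (T e) p = c p *s charge_conj (fibre_coord e p)"
    using LH_bundle_in_frame[OF T] by metis
  define l where "l = {(p, c p) |p. bproj X p = x}"
  have "l \<in> det_line X x"
    unfolding l_def det_line_eq
  proof (rule L.fibreI)
    fix p and g :: "'m::{finite,linorder} spinc" and \<mu> u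
    assume p: "bproj X p = x" and g: "g \<in> carrier spinc_group" "(\<mu>, u) \<in> g"
    let ?q = "ract X p g"
    have q: "bproj X ?q = x" using p g by simp
    define s :: "complex ^ 's" where "s = axis undefined 1"
    let ?e = "S.elem p s"
    have e: "?e \<in> ?S" using S.elem_in_fibre[OF p] by (simp add: spinor_bundle_eq)
    have es: "spinor_rep (\<mu>, u) (fibre_coord ?e ?q) = s"
      using S.fibre_coord_ract[OF e[unfolded spinor_bundle_eq] p g] by simp
    have "c p *s charge_conj s = fibre_coord (T ?e) p" using c[OF p e] by simp
    also have "\<dots> = spinor_rep (\<mu>, u) (c ?q *s charge_conj (fibre_coord ?e ?q))"
      using S.fibre_coord_ract[OF T_S[OF e, unfolded spinor_bundle_eq] p g] c[OF q e] by simp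
    also have "\<dots> = (u\<^sup>2 * c ?q) *s charge_conj s"
      by (subst charge_conj_spinor_rep[OF g, symmetric]) (simp only: es)
    finally show "c p = det_rep (\<mu>, u) (c ?q)"
      by (simp add: s_def axis_eq_0_iff)
  qed
  moreover have "T = line_endo x l"
  proof (rule extensionalityI[of _ ?S])
    show "T \<in> extensional ?S" using T by (auto simp: LH_bundle_def spinor_End_def PiE_def)
    show "line_endo x l \<in> extensional ?S" by (simp add: line_endo_def)
    fix e assume e: "e \<in> ?S"
    obtain p where p: "bproj X p = x" by (rule frame_point_exists)
    show "T e = line_endo x l e"
      by (rule spinor_ext[OF T_S[OF e] line_endo(1)[OF calculation e] p])
         (simp add: c[OF p e] line_endo(2)[OF calculation e p] L.fibre_coord_graph[OF p, of c, folded l_def])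
  qed
  ultimately show ?thesis by blast
qed

lemma bij_betw_line_endo: "bij_betw (line_endo x) (det_line X x) (LH_bundle X \<rho> x)"
proof (rule bij_betwI')
  fix l l' assume l: "l \<in> det_line X x" "l' \<in> det_line X x"
  obtain p where p: "bproj X p = x" by (rule frame_point_exists)
  define s :: "complex ^ 's" where "s = axis undefined 1"
  let ?e = "S.elem p s"
  have e: "?e \<in> spinor_bundle X \<rho> x" using S.elem_in_fibre[OF p] by (simp add: spinor_bundle_eq)
  show "(line_endo x l = line_endo x l') = (l = l')"
  proof
    assume "line_endo x l = line_endo x l'"
    then have "fibre_coord l p *s charge_conj s = fibre_coord l' p *s charge_conj s"
      using line_endo(2)[OF l(1) e p] line_endo(2)[OF l(2) e p] unfolding S.fibre_coord_elem by metis
    then have "fibre_coord l p = fibre_coord l' p" by (simp add: s_def axis_eq_0_iff)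
    then show "l = l'" using L.fibre_ext l p by (simp add: det_line_eq)
  qed simp
qed (use line_endo_in_LH_bundle LH_bundle_line_endo in auto)

lemma bij_line_endo_iff:
  assumes l: "l \<in> det_line X x"
  shows "bij_betw (line_endo x l) (spinor_bundle X \<rho> x) (spinor_bundle X \<rho> x) \<longleftrightarrow> (\<nexists>p. (p, 0) \<in> l)"
proof -
  let ?S = "spinor_bundle X \<rho> x"
  obtain p where p: "bproj X p = x" by (rule frame_point_exists)
  have elem: "S.elem p s \<in> ?S" for s using S.elem_in_fibre[OF p] by (simp add: spinor_bundle_eq)
  have inv: "bij_betw (line_endo x l) ?S ?S" if c: "fibre_coord l p \<noteq> 0"
  proof (rule bij_betwI')
    fix e e' assume e: "e \<in> ?S" "e' \<in> ?S"
    show "(line_endo x l e = line_endo x l e') = (e = e')"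
    proof
      assume "line_endo x l e = line_endo x l e'"
      then have "charge_conj (fibre_coord e p) = charge_conj (fibre_coord e' p)"
        using line_endo(2)[OF l e(1) p] line_endo(2)[OF l e(2) p] c by simp
      then have "fibre_coord e p = fibre_coord e' p" using bij_charge_conj by (metis bij_is_inj injD)
      then show "e = e'" by (rule spinor_ext[OF e p])
    qed simp
  next
    fix e assume e: "e \<in> ?S"
    obtain s where s: "charge_conj s = inverse (fibre_coord l p) *s fibre_coord e p"
      using bij_charge_conj by (metis bij_is_surj surjD)
    have "e = line_endo x l (S.elem p s)"
      by (rule spinor_ext[OF e line_endo(1)[OF l elem] p])
         (simp add: line_endo(2)[OF l elem p] s vector_smult_assoc c)
    then show "\<exists>e'\<in>?S. e = line_endo x l e'" using elem by blast
  qed (rule line_endo(1)[OF l])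
  have not_inv: "\<not> bij_betw (line_endo x l) ?S ?S" if q: "(q, 0) \<in> l" for q
  proof
    assume "bij_betw (line_endo x l) ?S ?S"
    then have inj: "inj_on (line_endo x l) ?S" by (rule bij_betw_imp_inj_on)
    have l': "l \<in> assoc_fibre X det_rep x" using l by (simp add: det_line_eq)
    have q': "bproj X q = x" "fibre_coord l q = 0"
      using L.fibre_bproj[OF l' q] L.fibre_coord_eq[OF l' q] by simp_all
    let ?s = "axis undefined 1 :: complex ^ 's"
    have e: "S.elem q s \<in> ?S" for s using S.elem_in_fibre[OF q'(1)] by (simp add: spinor_bundle_eq)
    have "line_endo x l (S.elem q ?s) = line_endo x l (S.elem q 0)"
      by (rule spinor_ext[OF line_endo(1)[OF l e] line_endo(1)[OF l e] q'(1)])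
         (simp add: line_endo(2)[OF l e q'(1)] q'(2))
    then have "S.elem q ?s = S.elem q 0" using inj e by (auto dest: inj_onD)
    then have "?s = 0" using S.fibre_coord_elem by metis
    then show False by (simp add: axis_eq_0_iff)
  qed
  have "(p, fibre_coord l p) \<in> l" using L.fibre_coord_mem l p by (simp add: det_line_eq)
  with inv not_inv show ?thesis by metis
qed

section \<open>Smoothness\<close>

lemma bounded_bilinear_vector_scale: "bounded_bilinear ((*s) :: complex \<Rightarrow> complex ^ 's \<Rightarrow> complex ^ 's)"
  unfolding bilinear_conv_bounded_bilinear[symmetric] bilinear_def
  by (auto intro!: linearI simp: vec.scale_left_distrib vec.scale_right_distrib vector_scaleR_eq
      vec.scale_left_commute vector_smult_assoc scaleR_conv_of_real)

lemma bounded_linear_rho_apply: "bounded_linear (\<lambda>\<mu>. \<rho> \<mu> *v s)"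
  by (rule linear_conv_bounded_linear[THEN iffD1], rule linearI)
     (simp_all add: rho_add rho_scale matrix_vector_mult_add_rdistrib matrix_vector_scaleR)

text \<open>Over the domain of a local section \<open>\<sigma>\<close>, a constant vector defines a smooth spinor field,
  because the transition functions are smooth.\<close>

lemma smooth_constant_spinor:
  assumes V: "(V, \<sigma>) \<in> local_sections X"
  shows "smooth_assoc_section_on X V (\<lambda>x. S.elem (\<sigma> x) s)"
proof -
  have elem: "S.elem (\<sigma> x) s \<in> assoc_fibre X spinor_rep x" if "x \<in> V" for x
    using S.elem_in_fibre local_section(2)[OF V that] .
  have "smooth_fun X (V \<inter> W) (\<lambda>x. fibre_coord (S.elem (\<sigma> x) s) (\<tau> x))"
    if W: "(W, \<tau>) \<in> local_sections X" for W \<tau>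
  proof (rule smooth_fun_localI)
    fix x assume "x \<in> V \<inter> W"
    then have "x \<in> W \<inter> V" by simp
    then obtain N \<mu> u where N: "open N" "x \<in> N" "N \<subseteq> W \<inter> V" "smooth_fun X N \<mu>" "smooth_fun X N u"
      and g: "\<And>y. y \<in> N \<Longrightarrow> \<exists>g\<in>carrier spinc_group. (\<mu> y, u y) \<in> g \<and> \<sigma> y = ract X (\<tau> y) g"
      using local_section_transition[OF W V] by blast
    have "smooth_fun X N (\<lambda>y. u y *s (\<rho> (\<mu> y) *v s))"
      using N by (intro smooth_fun_bounded_bilinear[OF bounded_bilinear_vector_scale]
          smooth_fun_bounded_linear[OF bounded_linear_rho_apply])
    moreover have "u y *s (\<rho> (\<mu> y) *v s) = fibre_coord (S.elem (\<sigma> y) s) (\<tau> y)" if y: "y \<in> N" for y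
    proof -
      obtain g where "g \<in> carrier spinc_group" "(\<mu> y, u y) \<in> g" "\<sigma> y = ract X (\<tau> y) g"
        using g[OF y] by blast
      moreover have "y \<in> V" "y \<in> W" using y N(3) by auto
      ultimately show ?thesis
        using S.fibre_coord_ract[OF elem local_section(2)[OF W], of y g "(\<mu> y, u y)"] by simp
    qed
    ultimately show "\<exists>N g. open N \<and> x \<in> N \<and> smooth_fun X N g \<and>
        (\<forall>y\<in>N. g y = fibre_coord (S.elem (\<sigma> y) s) (\<tau> y))"
      using N(1,2) by blast
  qed
  then show ?thesis
    using S.smooth_assoc_section_on_iff[OF local_section(1)[OF V] elem] by blast
qed

text \<open>
  Forward, the product rule applies to \<open>c J s\<close>. Backward, \<open>c\<close> is a component of the image of a
  constant spinor.
\<close>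

lemma smooth_line_endo_iff:
  assumes h: "\<And>x. h x \<in> det_line X x"
  shows "smooth_assoc_section_on X UNIV h \<longleftrightarrow> smooth_End_section X \<rho> (\<lambda>x. line_endo x (h x))"
proof
  assume smooth: "smooth_assoc_section_on X UNIV h"
  show "smooth_End_section X \<rho> (\<lambda>x. line_endo x (h x))"
    unfolding smooth_End_section_def
  proof (intro allI impI, elim conjE)
    fix U \<psi> assume U: "open U" and \<psi>: "\<forall>x\<in>U. \<psi> x \<in> spinor_bundle X \<rho> x"
      and "smooth_assoc_section_on X U \<psi>"
    then have \<psi>_smooth: "smooth_fun X (U \<inter> V) (\<lambda>x. fibre_coord (\<psi> x) (\<sigma> x))"
      if "(V, \<sigma>) \<in> local_sections X" for V \<sigma>
      using that S.smooth_assoc_section_on_iff[OF U, of \<psi>] by (auto simp: spinor_bundle_eq)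
    have h_smooth: "smooth_fun X V (\<lambda>x. fibre_coord (h x) (\<sigma> x))"
      if "(V, \<sigma>) \<in> local_sections X" for V \<sigma>
      using that smooth L.smooth_assoc_section_on_iff[of UNIV h] h by (auto simp: det_line_eq)
    have "smooth_fun X (U \<inter> V) (\<lambda>x. fibre_coord (line_endo x (h x) (\<psi> x)) (\<sigma> x))"
      if V: "(V, \<sigma>) \<in> local_sections X" for V \<sigma>
    proof (rule smooth_fun_localI)
      let ?g = "\<lambda>x. fibre_coord (h x) (\<sigma> x) *s charge_conj (fibre_coord (\<psi> x) (\<sigma> x))"
      have UV: "open (U \<inter> V)" using U local_section(1)[OF V] by blast
      have "smooth_fun X (U \<inter> V) ?g"
        using UV \<psi>_smooth[OF V] smooth_fun_subset[OF h_smooth[OF V], of "U \<inter> V"]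
        by (intro smooth_fun_bounded_bilinear[OF bounded_bilinear_vector_scale]
            smooth_fun_bounded_linear[OF bounded_linear_charge_conj]) auto
      moreover have "?g x = fibre_coord (line_endo x (h x) (\<psi> x)) (\<sigma> x)" if "x \<in> U \<inter> V" for x
        using line_endo(2)[OF h] \<psi> local_section(2)[OF V] that by simp
      ultimately show "\<exists>N g. open N \<and> x \<in> N \<and> smooth_fun X N g \<and>
          (\<forall>y\<in>N. g y = fibre_coord (line_endo y (h y) (\<psi> y)) (\<sigma> y))" if "x \<in> U \<inter> V" for x
        using UV that by blast
    qed
    moreover have "line_endo x (h x) (\<psi> x) \<in> assoc_fibre X spinor_rep x" if "x \<in> U" for x
      using line_endo(1)[OF h] \<psi> that by (simp add: spinor_bundle_eq)
    ultimately show "smooth_assoc_section_on X U (\<lambda>x. line_endo x (h x) (\<psi> x))"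
      using S.smooth_assoc_section_on_iff[OF U, of "\<lambda>x. line_endo x (h x) (\<psi> x)"] by blast
  qed
next
  assume smooth: "smooth_End_section X \<rho> (\<lambda>x. line_endo x (h x))"
  let ?i = "undefined :: 's"
  obtain s where s: "charge_conj s = axis ?i 1" using bij_charge_conj by (metis bij_is_surj surjD)
  have "smooth_fun X (UNIV \<inter> V) (\<lambda>x. fibre_coord (h x) (\<sigma> x))"
    if V: "(V, \<sigma>) \<in> local_sections X" for V \<sigma>
  proof (rule smooth_fun_localI)
    let ?\<psi> = "\<lambda>x. S.elem (\<sigma> x) s"
    let ?f = "\<lambda>x. fibre_coord (line_endo x (h x) (?\<psi> x)) (\<sigma> x)"
    have \<psi>: "?\<psi> x \<in> spinor_bundle X \<rho> x" if "x \<in> V" for x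
      using S.elem_in_fibre local_section(2)[OF V that] by (simp add: spinor_bundle_eq)
    have "smooth_assoc_section_on X V (\<lambda>x. line_endo x (h x) (?\<psi> x))"
      by (rule smooth[unfolded smooth_End_section_def, rule_format])
         (use smooth_constant_spinor[OF V] \<psi> local_section(1)[OF V] in auto)
    then have "smooth_fun X (V \<inter> V) ?f"
      using S.smooth_assoc_section_on_iff[OF local_section(1)[OF V], of "\<lambda>x. line_endo x (h x) (?\<psi> x)"]
        line_endo(1)[OF h \<psi>] V by (auto simp: spinor_bundle_eq)
    then have "smooth_fun X V (\<lambda>x. ?f x $ ?i)"
      using smooth_fun_bounded_linear[OF bounded_linear_vec_nth local_section(1)[OF V]] by simp
    moreover have "?f x $ ?i = fibre_coord (h x) (\<sigma> x)" if "x \<in> V" for x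
      using line_endo(2)[OF h \<psi>[OF that] local_section(2)[OF V that]] by (simp add: s)
    ultimately show "\<exists>N g. open N \<and> x \<in> N \<and> smooth_fun X N g \<and>
        (\<forall>y\<in>N. g y = fibre_coord (h y) (\<sigma> y))" if "x \<in> UNIV \<inter> V" for x
      using local_section(1)[OF V] that by blast
  qed
  then show "smooth_assoc_section_on X UNIV h"
    using L.smooth_assoc_section_on_iff[of UNIV h] h by (auto simp: det_line_eq)
qed

lemma section_correspondence:
  "bij_betw (\<lambda>h x. line_endo x (h x)) (det_line_sections X) (LH_sections X \<rho>)"
proof (rule bij_betwI')
  fix h h' assume h: "h \<in> det_line_sections X" "h' \<in> det_line_sections X"
  show "((\<lambda>x. line_endo x (h x)) = (\<lambda>x. line_endo x (h' x))) = (h = h')"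
  proof
    assume eq: "(\<lambda>x. line_endo x (h x)) = (\<lambda>x. line_endo x (h' x))"
    have "h x = h' x" for x
      using bij_betw_line_endo[of x] h fun_cong[OF eq, of x]
      by (auto simp: bij_betw_def det_line_sections_def dest: inj_onD)
    then show "h = h'" by blast
  qed simp
next
  fix h assume "h \<in> det_line_sections X"
  then show "(\<lambda>x. line_endo x (h x)) \<in> LH_sections X \<rho>"
    using line_endo_in_LH_bundle smooth_line_endo_iff[of h]
    by (simp add: det_line_sections_def LH_sections_def)
next
  fix H assume H: "H \<in> LH_sections X \<rho>"
  then have "\<exists>l. l \<in> det_line X x \<and> H x = line_endo x l" for x
    using LH_bundle_line_endo[of "H x" x] unfolding LH_sections_def by blast
  then obtain h where h: "\<And>x. h x \<in> det_line X x" "\<And>x. H x = line_endo x (h x)" by metis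
  then have "H = (\<lambda>x. line_endo x (h x))" by blast
  with H h(1) show "\<exists>h\<in>det_line_sections X. H = (\<lambda>x. line_endo x (h x))"
    using smooth_line_endo_iff[of h] by (auto simp: det_line_sections_def LH_sections_def)
qed

lemma End_support_line_endo:
  assumes "h \<in> det_line_sections X"
  shows "End_support X \<rho> (\<lambda>x. line_endo x (h x)) = det_line_support h"
  using bij_line_endo_iff[of "h _"] assms
  by (simp add: End_support_def det_line_support_def det_line_sections_def)

end

theorem theorem3p11:
  fixes X :: "('x::{t2_space,second_countable_topology}, 'm::{finite,linorder}, 'p) spinc_manifold"
    and \<rho> :: "'m cl \<Rightarrow> complex ^ 's ^ 's"
    and n :: nat
  assumes "is_spinc_manifold X"
    and "CARD('m) = 4 * n + 2"
    and "complex_spinor_module \<rho>"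
  shows "\<exists>\<Phi>. bij_betw \<Phi> (det_line_sections X) (LH_sections X \<rho>) \<and>
           (\<forall>h\<in>det_line_sections X. End_support X \<rho> (\<Phi> h) = det_line_support h)"
proof -
  interpret spinc_spinors X \<rho> n
    by unfold_locales (use assms in auto)
  show ?thesis using section_correspondence End_support_line_endo by blast
qed

end
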